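(* Let $k$ be a complete valuation field such that $|k|$ is dense in $\mathbb{R}_{\geq 0}$ and $k$ is not spherically complete, and let $\kappa$ be either an infinite cardinal or the class $\mathrm{Ord}$, satisfying the non-measurability condition. Then the forgetful (inclusion) functor $\mathscr{R}\hookrightarrow\mathrm{Ban}(k)$ does not admit a left adjoint functor, where $\mathscr{R}$ is the Reid class of Banach $k$-vector spaces with respect to $\kappa$.
   Context: A complete valuation field is a field $k$ with a complete non-Archimedean absolute value $|\cdot|\colon k\to\mathbb{R}_{\geq 0}$; $|k|$ denotes its image. $\mathrm{Ban}(k)$ is the category of (non-Archimedean, i.e. ultrametric) Banach $k$-vector spaces whose morphisms $V\to W$ are the $k$-linear maps of operator norm $\leq 1$; so $\cong$ means isometric $k$-linear isomorphism. Subclasses of $\mathrm{Ban}(k)$ are regarded as full subcategories. For a set $I$ and a family $\mathcal{W}\in\mathrm{Ban}(k)^I$, $\Pi_I\mathcal{W}$ is the bounded direct product: all $w=(w(i))_{i\in I}$ with $w(i)\in\mathcal{W}(i)$ and $\sup_{i\in I}\|w(i)\|<\infty$, with the supremum norm. $\Sigma_I\mathcal{W}$ is the completed direct sum: the closed subspace of those $w\in\Pi_I\mathcal{W}$ such that $\{i\in I:\|w(i)\|\geq\epsilon\}$ is finite for every $\epsilon>0$. $F_k$ is the class of Banach spaces isomorphic to $k^n$ with the maximum norm for some integer $n\geq 0$. "$\#I<\kappa$" means the cardinality of the set $I$ belongs to $\kappa$ (no restriction if $\kappa=\mathrm{Ord}$). Reid hierarchy: by recursion on the ordinal $\alpha$,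 $\mathscr{R}_{<\alpha}=\bigcup_{\beta<\alpha}\mathscr{R}_{\beta}$; $\Pi_{\alpha}$ is $F_k$ together with all $V\in\mathrm{Ban}(k)$ such that $V\cong\Pi_I\mathcal{W}$ for some set $I$ with $\#I<\kappa$ and some $\mathcal{W}\in(\mathscr{R}_{<\alpha})^I$; $\Sigma_{\alpha}$ is $F_k$ together with all $V$ such that $V\cong\Sigma_I\mathcal{W}$ for some such $I$, $\mathcal{W}$; $\mathscr{R}_{\alpha}=\Pi_{\alpha}\cup\Sigma_{\alpha}$. Reid class is $\mathscr{R}=\bigcup_{\alpha\in\mathrm{Ord}}\mathscr{R}_{\alpha}$. A set $X$ is $\omega_1$-measurable if it is uncountable and admits a non-principal ultrafilter closed under countable intersections; $\kappa$ satisfies the non-measurability condition if no $\alpha\in\kappa$ is $\omega_1$-measurable. *)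

theory Defs
  imports "HOL-Analysis.Abstract_Metric_Spaces" "HOL-Library.Countable_Set"
    "HOL-Library.FuncSet" "HOL-Algebra.Module"
begin

unbundle cardinal_syntax

section \<open>The set-theoretic universe\<close>

text \<open>
  A Grothendieck universe: a type whose cardinality is a strongly inaccessible cardinal, with
  the subsets of strictly smaller cardinality playing the role of the sets and arbitrary subsets
  that of the classes.  If \<open>\<lambda>\<close> is inaccessible, the stage \<open>V\<^sub>\<lambda>\<close> of the cumulative hierarchy is
  such a type, and its small subsets are exactly its elements.  HOL proves no type to be an
  instance, just as ZFC does not prove that there is a universe.

  The canonical well-order \<open>|UNIV|\<close> of the universe has order type \<open>\<lambda>\<close>, so it serves as the class
  Ord of all ordinals: the element \<open>\<alpha>\<close> stands for the order type of
  \<open>underS |UNIV| \<alpha>\<close>, and every order type of a well-ordered small set arises exactly once.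
\<close>

class universe =
  assumes universe_uncountable: "natLeq <o |UNIV :: 'a set|"
    and universe_regular: "regularCard |UNIV :: 'a set|"
    and universe_strong_limit:
      "\<And>A :: 'a set. |A| <o |UNIV :: 'a set| \<Longrightarrow> |Pow A| <o |UNIV :: 'a set|"

definition small :: "'u::universe set \<Rightarrow> bool" where
  "small A \<longleftrightarrow> |A| <o |UNIV :: 'u set|"

abbreviation Ord :: "'u::universe rel" where
  "Ord \<equiv> |UNIV :: 'u set|"

text \<open>
  The parameter \<open>\<kappa>\<close> is given by its well-order, so that \<open>#I < \<kappa>\<close> is \<open>|I| <o \<kappa>\<close>; for \<open>\<kappa> = Ord\<close> the
  latter only says that \<open>I\<close> is a set.
\<close>

definition infinite_cardinal_or_Ord :: "'u::universe rel \<Rightarrow> bool" where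
  "infinite_cardinal_or_Ord \<kappa> \<longleftrightarrow>
     (Card_order \<kappa> \<and> infinite (Field \<kappa>) \<and> \<kappa> <o (Ord :: 'u rel)) \<or> \<kappa> = Ord"

definition ultrafilter_on :: "'a set \<Rightarrow> 'a set set \<Rightarrow> bool" where
  "ultrafilter_on X U \<longleftrightarrow>
     U \<subseteq> Pow X \<and> X \<in> U \<and> {} \<notin> U \<and>
     (\<forall>A\<in>U. \<forall>B. A \<subseteq> B \<and> B \<subseteq> X \<longrightarrow> B \<in> U) \<and>
     (\<forall>A\<in>U. \<forall>B\<in>U. A \<inter> B \<in> U) \<and>
     (\<forall>A. A \<subseteq> X \<longrightarrow> A \<in> U \<or> X - A \<in> U)"

definition omega1_measurable :: "'a set \<Rightarrow> bool" where
  "omega1_measurable X \<longleftrightarrow> uncountable X \<and>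
     (\<exists>U. ultrafilter_on X U \<and>
          \<not> (\<exists>x\<in>X. U = {A. A \<subseteq> X \<and> x \<in> A}) \<and>
          (\<forall>A :: nat \<Rightarrow> 'a set. (\<forall>n. A n \<in> U) \<longrightarrow> (\<Inter>n. A n) \<in> U))"

text \<open>The ordinals in \<open>\<kappa>\<close> are the proper initial segments of its well-order.\<close>

definition non_measurability_condition :: "'u::universe rel \<Rightarrow> bool" where
  "non_measurability_condition \<kappa> \<longleftrightarrow> (\<forall>\<alpha>\<in>Field \<kappa>. \<not> omega1_measurable (underS \<kappa> \<alpha>))"


section \<open>Valuation fields\<close>

definition complete_valuation :: "('k::field \<Rightarrow> real) \<Rightarrow> bool" where
  "complete_valuation v \<longleftrightarrow>
     (\<forall>a. 0 \<le> v a) \<and> (\<forall>a. v a = 0 \<longleftrightarrow> a = 0) \<and>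
     (\<forall>a b. v (a * b) = v a * v b) \<and>
     (\<forall>a b. v (a + b) \<le> max (v a) (v b)) \<and>
     Metric_space.mcomplete UNIV (\<lambda>a b. v (a - b))"

definition spherically_complete :: "('k::field \<Rightarrow> real) \<Rightarrow> bool" where
  "spherically_complete v \<longleftrightarrow>
     (\<forall>c r. (\<forall>n::nat. 0 < r n) \<and>
            decseq (\<lambda>n. Metric_space.mcball UNIV (\<lambda>a b. v (a - b)) (c n) (r n)) \<longrightarrow>
            (\<Inter>n. Metric_space.mcball UNIV (\<lambda>a b. v (a - b)) (c n) (r n)) \<noteq> {})"

text \<open>The field as a ring with carrier, as needed for modules over it.\<close>

definition scalars :: "'k::field ring" where
  "scalars = \<lparr>carrier = UNIV, mult = (*), one = 1, zero = 0, add = (+)\<rparr>"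


section \<open>Banach spaces\<close>

text \<open>
  The record type of modules extends that of rings; as for every module in the library, the
  multiplication and the unit of a space are irrelevant.
\<close>

record ('k, 'v) nspace = "('k, 'v) module" +
  nrm :: "'v \<Rightarrow> real"

text \<open>
  The locale of metric spaces demands nonnegativity and symmetry also off the carrier, hence the
  value \<open>0\<close> there.
\<close>

definition norm_dist :: "('k, 'v) nspace \<Rightarrow> 'v \<Rightarrow> 'v \<Rightarrow> real" where
  "norm_dist V x y =
     (if x \<in> carrier V \<and> y \<in> carrier V then nrm V (x \<ominus>\<^bsub>V\<^esub> y) else 0)"

definition ultrametric_banach :: "('k::field \<Rightarrow> real) \<Rightarrow> ('k, 'v) nspace \<Rightarrow> bool" where
  "ultrametric_banach v V \<longleftrightarrow>
     Module.module scalars V \<and>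
     (\<forall>x\<in>carrier V. 0 \<le> nrm V x) \<and>
     (\<forall>x\<in>carrier V. nrm V x = 0 \<longleftrightarrow> x = \<zero>\<^bsub>V\<^esub>) \<and>
     (\<forall>a. \<forall>x\<in>carrier V. nrm V (a \<odot>\<^bsub>V\<^esub> x) = v a * nrm V x) \<and>
     (\<forall>x\<in>carrier V. \<forall>y\<in>carrier V. nrm V (x \<oplus>\<^bsub>V\<^esub> y) \<le> max (nrm V x) (nrm V y)) \<and>
     Metric_space.mcomplete (carrier V) (norm_dist V)"

definition linear_on :: "('k, 'v) nspace \<Rightarrow> ('k, 'w) nspace \<Rightarrow> ('v \<Rightarrow> 'w) \<Rightarrow> bool" where
  "linear_on V W f \<longleftrightarrow>
     f \<in> carrier V \<rightarrow> carrier W \<and>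
     (\<forall>x\<in>carrier V. \<forall>y\<in>carrier V. f (x \<oplus>\<^bsub>V\<^esub> y) = f x \<oplus>\<^bsub>W\<^esub> f y) \<and>
     (\<forall>a. \<forall>x\<in>carrier V. f (a \<odot>\<^bsub>V\<^esub> x) = a \<odot>\<^bsub>W\<^esub> f x)"

definition isometrically_isomorphic ::
    "('k, 'v) nspace \<Rightarrow> ('k, 'w) nspace \<Rightarrow> bool" (infix \<open>\<cong>\<^sub>B\<close> 50) where
  "V \<cong>\<^sub>B W \<longleftrightarrow>
     (\<exists>f. linear_on V W f \<and> bij_betw f (carrier V) (carrier W) \<and>
          (\<forall>x\<in>carrier V. nrm W (f x) = nrm V x))"

text \<open>The inserted \<open>0\<close> makes the norm on the empty product \<open>0\<close>; otherwise it has no effect.\<close>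

definition bounded_product :: "'i set \<Rightarrow> ('i \<Rightarrow> ('k, 'v) nspace) \<Rightarrow> ('k, 'i \<Rightarrow> 'v) nspace" where
  "bounded_product I W =
     \<lparr>carrier = {w \<in> (\<Pi>\<^sub>E i\<in>I. carrier (W i)). bdd_above ((\<lambda>i. nrm (W i) (w i)) ` I)},
      mult = undefined, one = undefined,
      zero = (\<lambda>i\<in>I. \<zero>\<^bsub>W i\<^esub>),
      add = (\<lambda>w w'. \<lambda>i\<in>I. w i \<oplus>\<^bsub>W i\<^esub> w' i),
      smult = (\<lambda>a w. \<lambda>i\<in>I. a \<odot>\<^bsub>W i\<^esub> w i),
      nrm = (\<lambda>w. Sup (insert 0 ((\<lambda>i. nrm (W i) (w i)) ` I)))\<rparr>"

definition completed_sum :: "'i set \<Rightarrow> ('i \<Rightarrow> ('k, 'v) nspace) \<Rightarrow> ('k, 'i \<Rightarrow> 'v) nspace" where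
  "completed_sum I W = (bounded_product I W)
     \<lparr>carrier := {w \<in> carrier (bounded_product I W).
                    \<forall>\<epsilon>>0. finite {i \<in> I. \<epsilon> \<le> nrm (W i) (w i)}}\<rparr>"

definition scalar_space :: "('k::field \<Rightarrow> real) \<Rightarrow> ('k, 'k) nspace" where
  "scalar_space v =
     \<lparr>carrier = UNIV, mult = (*), one = 1, zero = 0, add = (+), smult = (*), nrm = v\<rparr>"

text \<open>\<open>k\<^sup>n\<close>; for finitely many factors the supremum norm is the maximum norm.\<close>

definition power_space :: "('k::field \<Rightarrow> real) \<Rightarrow> nat \<Rightarrow> ('k, nat \<Rightarrow> 'k) nspace" where
  "power_space v n = bounded_product {..<n} (\<lambda>_. scalar_space v)"


section \<open>Categories, functors and adjoints\<close>

text \<open>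
  \<open>Comp C X Y Z g f\<close> is the composite of \<open>f : X \<rightarrow> Y\<close> and \<open>g : Y \<rightarrow> Z\<close>.
\<close>

record ('o, 'm) cat =
  Obj :: "'o set"
  Hom :: "'o \<Rightarrow> 'o \<Rightarrow> 'm set"
  Ident :: "'o \<Rightarrow> 'm"
  Comp :: "'o \<Rightarrow> 'o \<Rightarrow> 'o \<Rightarrow> 'm \<Rightarrow> 'm \<Rightarrow> 'm"

definition full_subcategory :: "('o, 'm) cat \<Rightarrow> 'o set \<Rightarrow> ('o, 'm) cat" where
  "full_subcategory C S = C\<lparr>Obj := Obj C \<inter> S\<rparr>"

record ('o, 'm, 'p, 'n) func =
  fobj :: "'o \<Rightarrow> 'p"
  fmor :: "'o \<Rightarrow> 'o \<Rightarrow> 'm \<Rightarrow> 'n"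

definition is_functor ::
    "('o, 'm) cat \<Rightarrow> ('p, 'n) cat \<Rightarrow> ('o, 'm, 'p, 'n) func \<Rightarrow> bool" where
  "is_functor C D F \<longleftrightarrow>
     (\<forall>X\<in>Obj C. fobj F X \<in> Obj D) \<and>
     (\<forall>X\<in>Obj C. \<forall>Y\<in>Obj C. \<forall>f\<in>Hom C X Y. fmor F X Y f \<in> Hom D (fobj F X) (fobj F Y)) \<and>
     (\<forall>X\<in>Obj C. fmor F X X (Ident C X) = Ident D (fobj F X)) \<and>
     (\<forall>X\<in>Obj C. \<forall>Y\<in>Obj C. \<forall>Z\<in>Obj C. \<forall>f\<in>Hom C X Y. \<forall>g\<in>Hom C Y Z.
        fmor F X Z (Comp C X Y Z g f) =
        Comp D (fobj F X) (fobj F Y) (fobj F Z) (fmor F Y Z g) (fmor F X Y f))"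

definition inclusion_functor :: "('o, 'm, 'o, 'm) func" where
  "inclusion_functor = \<lparr>fobj = (\<lambda>X. X), fmor = (\<lambda>X Y f. f)\<rparr>"

text \<open>
  \<open>L : D \<rightarrow> C\<close> is left adjoint to a functor \<open>G : C \<rightarrow> D\<close> via bijections
  \<open>\<phi> X Y : Hom (L X) Y \<rightarrow> Hom X (G Y)\<close> that are natural in \<open>X\<close> and \<open>Y\<close> jointly.
\<close>

definition is_left_adjoint ::
    "('o, 'm) cat \<Rightarrow> ('p, 'n) cat \<Rightarrow> ('p, 'n, 'o, 'm) func \<Rightarrow> ('o, 'm, 'p, 'n) func \<Rightarrow> bool"
  where
  "is_left_adjoint C D L G \<longleftrightarrow>
     is_functor D C L \<and>
     (\<exists>\<phi>.
       (\<forall>X\<in>Obj D. \<forall>Y\<in>Obj C.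
          bij_betw (\<phi> X Y) (Hom C (fobj L X) Y) (Hom D X (fobj G Y))) \<and>
       (\<forall>X\<in>Obj D. \<forall>X'\<in>Obj D. \<forall>Y\<in>Obj C. \<forall>Y'\<in>Obj C.
          \<forall>f\<in>Hom D X' X. \<forall>g\<in>Hom C Y Y'. \<forall>h\<in>Hom C (fobj L X) Y.
          \<phi> X' Y'
            (Comp C (fobj L X') (fobj L X) Y'
               (Comp C (fobj L X) Y Y' g h) (fmor L X' X f)) =
          Comp D X' X (fobj G Y')
            (Comp D X (fobj G Y) (fobj G Y') (fmor G Y Y' g) (\<phi> X Y h)) f))"

definition has_left_adjoint ::
    "('o, 'm) cat \<Rightarrow> ('p, 'n) cat \<Rightarrow> ('o, 'm, 'p, 'n) func \<Rightarrow> bool" where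
  "has_left_adjoint C D G \<longleftrightarrow> (\<exists>L. is_left_adjoint C D L G)"


section \<open>The category of Banach spaces and the Reid hierarchy\<close>

definition banach_objects :: "('k::field \<Rightarrow> real) \<Rightarrow> ('k, 'u::universe) nspace set" where
  "banach_objects v = {V. small (carrier V) \<and> ultrametric_banach v V}"

text \<open>
  Morphisms are extensional, so that two of them are equal iff they agree on the domain.
\<close>

definition Ban :: "('k::field \<Rightarrow> real) \<Rightarrow> (('k, 'u::universe) nspace, 'u \<Rightarrow> 'u) cat" where
  "Ban v =
     \<lparr>Obj = banach_objects v,
      Hom = (\<lambda>V W. {f \<in> extensional (carrier V). linear_on V W f \<and>
                       (\<forall>x\<in>carrier V. nrm W (f x) \<le> nrm V x)}),
      Ident = (\<lambda>V. \<lambda>x\<in>carrier V. x),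
      Comp = (\<lambda>U V W g f. compose (carrier U) g f)\<rparr>"

definition finite_free :: "('k::field \<Rightarrow> real) \<Rightarrow> ('k, 'u::universe) nspace set" where
  "finite_free v = {V \<in> banach_objects v. \<exists>n. V \<cong>\<^sub>B power_space v n}"

definition products_of :: "('k::field \<Rightarrow> real) \<Rightarrow> 'u::universe rel \<Rightarrow>
    ('k, 'u) nspace set \<Rightarrow> ('k, 'u) nspace set" where
  "products_of v \<kappa> S = {V \<in> banach_objects v.
     \<exists>(I :: 'u set) W. |I| <o \<kappa> \<and> (\<forall>i\<in>I. W i \<in> S) \<and> V \<cong>\<^sub>B bounded_product I W}"

definition sums_of :: "('k::field \<Rightarrow> real) \<Rightarrow> 'u::universe rel \<Rightarrow>
    ('k, 'u) nspace set \<Rightarrow> ('k, 'u) nspace set" where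
  "sums_of v \<kappa> S = {V \<in> banach_objects v.
     \<exists>(I :: 'u set) W. |I| <o \<kappa> \<and> (\<forall>i\<in>I. W i \<in> S) \<and> V \<cong>\<^sub>B completed_sum I W}"

lemma wf_Ord: "wf (Ord - Id :: 'u::universe rel)"
  using card_of_Well_order[of "UNIV :: 'u set"] by (simp add: well_order_on_def)

text \<open>The ordinals below \<open>\<alpha>\<close> are the elements of \<open>underS Ord \<alpha>\<close>.\<close>

function reid_hierarchy :: "('k::field \<Rightarrow> real) \<Rightarrow> 'u::universe rel \<Rightarrow> 'u \<Rightarrow>
    ('k, 'u) nspace set" where
  "reid_hierarchy v \<kappa> \<alpha> =
     (finite_free v \<union> products_of v \<kappa> (\<Union>\<beta>\<in>underS Ord \<alpha>. reid_hierarchy v \<kappa> \<beta>)) \<union>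
     (finite_free v \<union> sums_of v \<kappa> (\<Union>\<beta>\<in>underS Ord \<alpha>. reid_hierarchy v \<kappa> \<beta>))"
  by pat_completeness auto
termination
  by (relation "inv_image (Ord - Id) (\<lambda>(v, \<kappa>, \<alpha>). \<alpha>)")
     (auto simp: underS_def wf_Ord)

declare reid_hierarchy.simps [simp del]

definition reid_class :: "('k::field \<Rightarrow> real) \<Rightarrow> 'u::universe rel \<Rightarrow> ('k, 'u) nspace set" where
  "reid_class v \<kappa> = (\<Union>\<alpha>. reid_hierarchy v \<kappa> \<alpha>)"

definition reid_category :: "('k::field \<Rightarrow> real) \<Rightarrow> 'u::universe rel \<Rightarrow>
    (('k, 'u) nspace, 'u \<Rightarrow> 'u) cat" where
  "reid_category v \<kappa> = full_subcategory (Ban v) (reid_class v \<kappa>)"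

lemma is_functor_inclusion:
  "is_functor (full_subcategory C S) C inclusion_functor"
  by (auto simp: is_functor_def full_subcategory_def inclusion_functor_def)

end

theory Submission
  imports Defs
begin

text \<open>
  A full reflective subcategory is closed under limits, so it suffices to find a Banach space that
  is a limit of copies of \<open>k\<close> but is not isometric to any Reid space.  Such a space exists already in
  dimension two.

  Since \<open>k\<close> is not spherically complete, it has a pseudo-Cauchy sequence \<open>lam\<close> without a
  pseudo-limit (\<open>not_spherically_complete_imp_divergent\<close>): the gaps
  \<open>d n = v (lam (Suc n) - lam n)\<close> strictly decrease, to a positive limit by completeness, and no
  \<open>x\<close> satisfies \<open>v (x - lam n) \<le> d n\<close> for all \<open>n\<close>.  Give \<open>k\<^sup>2\<close> the norm
  \<open>sup\<^sub>n v (x - y * lam n) / d n\<close>.  The points \<open>(lam n, 1)\<close> then have strictly decreasing norms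
  (\<open>plane_norm_strictly_decreasing\<close>).

  In a Reid space this cannot happen: along every linear surjection \<open>T\<close> from \<open>k\<^sup>2\<close> onto it, the norm
  of \<open>T (lam n, 1)\<close> is eventually constant.  For the target \<open>k\<close> this says that
  \<open>v (a * lam n + b)\<close> stabilises, because \<open>- b / a\<close> is not a pseudo-limit.  The property passes to
  products and sums (\<open>stabilising_product\<close>), since at most two factors are nonzero when the whole is a
  quotient of \<open>k\<^sup>2\<close>, and so to the whole hierarchy (\<open>stabilising_reid_hierarchy\<close>).

  Suppose now that the plane had a reflection \<open>\<eta>\<close> into a Reid space \<open>R\<close>.  The norm of the plane is
  the supremum of the functionals \<open>f n (x, y) = (x - y * lam n) / (lam (Suc n) - lam n)\<close>, which
  extend along \<open>\<eta>\<close> to contractions \<open>R \<rightarrow> k\<close>; hence \<open>\<eta>\<close> is isometric.  Uniqueness of extensions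
  makes the extensions of all \<open>f n\<close> satisfy the linear relations of the \<open>f n\<close>, so they are the
  coordinates of a contraction from \<open>R\<close> back to the plane.  It is inverse to \<open>\<eta>\<close>, again by
  uniqueness, and the plane would be isometric to \<open>R\<close>, contradicting stabilisation
  (\<open>no_stabilising_reflection\<close>).
\<close>

section \<open>Pseudo-Cauchy sequences without pseudo-limits\<close>

locale complete_valued_field =
  fixes v :: "'k::field \<Rightarrow> real"
  assumes complete_valuation: "complete_valuation v"
begin

lemma nonneg [simp]: "0 \<le> v a"
  and eq_0_iff [simp]: "v a = 0 \<longleftrightarrow> a = 0"
  and mult: "v (a * b) = v a * v b"
  and ultrametric: "v (a + b) \<le> max (v a) (v b)"
  using complete_valuation by (auto simp: complete_valuation_def)

lemma zero [simp]: "v 0 = 0"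
  by simp

lemma pos_iff [simp]: "0 < v a \<longleftrightarrow> a \<noteq> 0"
  using nonneg[of a] eq_0_iff[of a] by (metis less_le)

lemma one [simp]: "v 1 = 1"
  using mult[of 1 1] by simp

lemma minus [simp]: "v (- a) = v a"
proof -
  have "v (-1) * v (-1) = 1"
    using mult[of "-1" "-1"] by simp
  hence "v (-1) = 1"
    using nonneg[of "-1"] by (simp add: square_eq_1_iff)
  thus ?thesis
    using mult[of "-1" a] by simp
qed

lemma minus_commute: "v (a - b) = v (b - a)"
  using minus[of "a - b"] by simp

lemma ultrametric_diff: "v (a - b) \<le> max (v a) (v b)"
  using ultrametric[of a "- b"] by simp

lemma divide: "v (a / b) = v a / v b"
proof (cases "b = 0")
  case False
  thus ?thesis
    using mult[of "a / b" b] by (simp add: field_simps)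
qed simp

lemma add_dominant: "v a < v b \<Longrightarrow> v (a + b) = v b"
  using ultrametric[of a b] ultrametric_diff[of "a + b" a] by (simp add: max_def split: if_splits)

lemma metric: "Metric_space UNIV (\<lambda>a b. v (a - b))"
proof
  show "v (x - y) = v (y - x)" for x y
    by (rule minus_commute)
  show "v (x - z) \<le> v (x - y) + v (y - z)" for x y z
  proof -
    have "v (x - z) \<le> max (v (x - y)) (v (y - z))"
      using ultrametric[of "x - y" "y - z"] by simp
    also have "\<dots> \<le> v (x - y) + v (y - z)"
      by (simp add: max_def)
    finally show ?thesis .
  qed
qed auto

lemma Cauchy_converges:
  fixes s :: "nat \<Rightarrow> 'k"
  assumes "\<And>e. e > 0 \<Longrightarrow> \<exists>M. \<forall>m\<ge>M. \<forall>n\<ge>M. v (s m - s n) < e"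
  obtains l where "\<And>e. e > 0 \<Longrightarrow> \<exists>M. \<forall>n\<ge>M. v (s n - l) < e"
proof -
  interpret Metric_space UNIV "\<lambda>a b. v (a - b)"
    by (rule metric)
  have "mcomplete"
    using complete_valuation by (simp add: complete_valuation_def)
  moreover have "MCauchy s"
    using assms by (simp add: MCauchy_def)
  ultimately obtain l where "limitin mtopology s l sequentially"
    by (auto simp: mcomplete_def)
  thus ?thesis
    using that[of l] by (auto simp: limit_metric_sequentially)
qed

end

locale divergent_pseudo_Cauchy = complete_valued_field v for v :: "'k::field \<Rightarrow> real" +
  fixes lam :: "nat \<Rightarrow> 'k"
  assumes gaps_decrease: "v (lam (Suc (Suc n)) - lam (Suc n)) < v (lam (Suc n) - lam n)"
    and no_pseudo_limit: "\<exists>n. v (lam (Suc n) - lam n) < v (x - lam n)"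
begin

abbreviation gap :: "nat \<Rightarrow> 'k" where
  "gap n \<equiv> lam (Suc n) - lam n"

lemma gap_strict_antimono: "m < n \<Longrightarrow> v (gap n) < v (gap m)"
  using lift_Suc_mono_less[of "\<lambda>n. - v (gap n)" m n] gaps_decrease by simp

lemma gap_nonzero [simp]: "lam (Suc n) \<noteq> lam n"
  using gaps_decrease[of n] nonneg[of "gap (Suc n)"] by (metis eq_iff_diff_eq_0 not_le zero)

lemma diff_eq_gap: "m < n \<Longrightarrow> v (lam n - lam m) = v (gap m)"
proof (induction n)
  case (Suc n)
  show ?case
  proof (cases "m = n")
    case False
    hence "m < n"
      using Suc.prems by simp
    hence "v (gap n) < v (lam n - lam m)"
      using Suc.IH gap_strict_antimono by simp
    hence "v (gap n + (lam n - lam m)) = v (lam n - lam m)"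
      by (rule add_dominant)
    thus ?thesis
      using Suc.IH \<open>m < n\<close> by simp
  qed simp
qed simp

lemma diff_le_gap: "m \<le> n \<Longrightarrow> v (lam n - lam m) \<le> v (gap m)"
  using diff_eq_gap[of m n] by (cases "m = n") auto

text \<open>
  Otherwise the sequence would be Cauchy, and its limit a pseudo-limit.
\<close>

lemma gap_bounded_below:
  "\<exists>r>0. \<forall>n. r \<le> v (gap n)"
proof (rule ccontr)
  assume no_bound: "\<not> ?thesis"
  have small: "\<exists>n. v (gap n) < e" if pos: "e > 0" for e :: real
  proof (rule ccontr)
    assume "\<nexists>n. v (gap n) < e"
    hence "e \<le> v (gap n)" for n
      by (simp add: not_less)
    thus False
      using no_bound pos by blast
  qed
  obtain x where x: "\<And>e. e > 0 \<Longrightarrow> \<exists>M. \<forall>n\<ge>M. v (lam n - x) < e"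
  proof (rule Cauchy_converges)
    fix e :: real
    assume "e > 0"
    then obtain M where M: "v (gap M) < e"
      using small by blast
    have "v (lam m - lam n) < e" if "m \<ge> M" "n \<ge> M" for m n
      using ultrametric_diff[of "lam m - lam M" "lam n - lam M"] diff_le_gap[OF \<open>m \<ge> M\<close>]
        diff_le_gap[OF \<open>n \<ge> M\<close>] M by simp
    thus "\<exists>M. \<forall>m\<ge>M. \<forall>n\<ge>M. v (lam m - lam n) < e"
      by blast
  qed blast
  obtain n where n: "v (gap n) < v (x - lam n)"
    using no_pseudo_limit by blast
  obtain M where M: "\<forall>m\<ge>M. v (lam m - x) < v (gap n)"
    using x[of "v (gap n)"] by auto
  have "v (x - lam n) \<le> max (v (lam (max M n) - x)) (v (lam (max M n) - lam n))"
    using ultrametric_diff[of "lam (max M n) - lam n" "lam (max M n) - x"] by (simp add: max.commute)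
  also have "\<dots> \<le> v (gap n)"
    using M diff_le_gap[of n "max M n"] by (simp add: less_imp_le)
  finally show False
    using n by simp
qed

text \<open>
  As \<open>- b / a\<close> is not a pseudo-limit, its distance to some \<open>lam N\<close> exceeds the gap there, and the
  later members of the sequence are too close to \<open>lam N\<close> to change that distance.
\<close>

lemma eventually_constant:
  "\<exists>c. \<forall>\<^sub>F n in sequentially. v (a * lam n + b) = c"
proof (cases "a = 0")
  case False
  obtain N where N: "v (gap N) < v (- b / a - lam N)"
    using no_pseudo_limit by blast
  have "v (a * lam n + b) = v a * v (- b / a - lam N)" if "n \<ge> N" for n
  proof -
    have "v (lam N - lam n) < v (- b / a - lam N)"
      using N diff_le_gap[OF that] by (simp add: minus_commute)
    hence "v ((lam N - lam n) + (- b / a - lam N)) = v (- b / a - lam N)"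
      by (rule add_dominant)
    moreover have "(lam N - lam n) + (- b / a - lam N) = - b / a - lam n"
      by simp
    ultimately have "v (a * (- b / a - lam n)) = v a * v (- b / a - lam N)"
      by (simp only: mult)
    moreover have "a * (- b / a - lam n) = - (a * lam n + b)"
      using False by (simp add: field_simps)
    ultimately show ?thesis
      by (metis minus)
  qed
  thus ?thesis
    unfolding eventually_sequentially by blast
qed auto

end

text \<open>
  A decreasing sequence of balls with empty intersection has a subsequence in which no centre lies
  in the next ball.  Then consecutive centres are further apart than the radius of the later ball,
  and all subsequent centres lie in that ball.
\<close>

lemma (in complete_valued_field) not_spherically_complete_imp_divergent:
  assumes "\<not> spherically_complete v"
  obtains lam where "divergent_pseudo_Cauchy v lam"
proof -
  interpret Metric_space UNIV "\<lambda>a b. v (a - b)"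
    by (rule metric)
  obtain c r where r: "\<And>n. 0 < r n" and dec: "decseq (\<lambda>n. mcball (c n) (r n))"
    and empty: "(\<Inter>n. mcball (c n) (r n)) = {}"
    using assms by (auto simp: spherically_complete_def)
  define B where "B n = mcball (c n) (r n)" for n
  have in_B: "x \<in> B n \<longleftrightarrow> v (x - c n) \<le> r n" for x n
    by (simp add: B_def mcball_def minus_commute)
  have antimono: "B n \<subseteq> B m" if "m \<le> n" for m n
    using dec that by (auto simp: B_def decseq_def)
  have centre: "c n \<in> B m" if "m \<le> n" for m n
    using antimono[OF that] in_B[of "c n" n] r[of n] by auto
  have "\<exists>m. c n \<notin> B m" for n
    using empty unfolding B_def by blast
  then obtain escape where escape: "c n \<notin> B (escape n)" for n
    by metis
  have escape_gt: "n < escape n" for n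
    using centre[of "escape n" n] escape[of n] by force
  define s where "s = rec_nat 0 (\<lambda>_. escape)"
  have s_Suc: "s (Suc n) = escape (s n)" for n
    by (simp add: s_def)
  have "n \<le> s n" for n
  proof (induction n)
    case (Suc n)
    thus ?case
      using escape_gt[of "s n"] by (simp add: s_Suc)
  qed simp
  have gap_gt: "r (s (Suc n)) < v (c (s (Suc n)) - c (s n))" for n
    using escape[of "s n"] by (simp add: in_B s_Suc minus_commute not_le)
  have gap_le: "v (c (s (Suc (Suc n))) - c (s (Suc n))) \<le> r (s (Suc n))" for n
    using centre[of "s (Suc n)" "s (Suc (Suc n))"] escape_gt[of "s (Suc n)"]
    by (simp add: in_B s_Suc less_imp_le)
  have "divergent_pseudo_Cauchy v (\<lambda>n. c (s n))"
  proof (unfold_locales, goal_cases)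
    case (1 n)
    show ?case
      using gap_gt[of n] gap_le[of n] by simp
  next
    case (2 x)
    obtain m where "x \<notin> B m"
      using empty unfolding B_def by blast
    hence "x \<notin> B (s (Suc m))"
      using antimono[of m "s (Suc m)"] \<open>Suc m \<le> s (Suc m)\<close> by auto
    hence "v (c (s (Suc (Suc m))) - c (s (Suc m))) < v (x - c (s (Suc m)))"
      using gap_le[of m] by (simp add: in_B)
    thus ?case
      by blast
  qed
  thus ?thesis
    by (rule that)
qed

section \<open>Ultrametric Banach spaces\<close>

lemma scalars_cring: "cring (scalars :: 'k::field ring)"
proof (rule cringI)
  show "abelian_group (scalars :: 'k ring)"
    by (rule abelian_groupI) (auto simp: scalars_def algebra_simps intro: exI[of _ "- _"])
  show "Group.comm_monoid (scalars :: 'k ring)"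
    by (rule comm_monoidI) (auto simp: scalars_def)
qed (simp add: scalars_def algebra_simps)

lemma
  assumes "ultrametric_banach v V"
  shows zero_closed: "\<zero>\<^bsub>V\<^esub> \<in> carrier V"
    and add_closed: "x \<in> carrier V \<Longrightarrow> y \<in> carrier V \<Longrightarrow> x \<oplus>\<^bsub>V\<^esub> y \<in> carrier V"
    and smult_closed: "x \<in> carrier V \<Longrightarrow> a \<odot>\<^bsub>V\<^esub> x \<in> carrier V"
    and add_zero: "\<zero>\<^bsub>V\<^esub> \<oplus>\<^bsub>V\<^esub> \<zero>\<^bsub>V\<^esub> = \<zero>\<^bsub>V\<^esub>"
    and smult_zero: "a \<odot>\<^bsub>V\<^esub> \<zero>\<^bsub>V\<^esub> = \<zero>\<^bsub>V\<^esub>"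
    and nrm_zero: "nrm V \<zero>\<^bsub>V\<^esub> = 0"
proof -
  interpret Module.module scalars V
    using assms by (simp add: ultrametric_banach_def)
  show "\<zero>\<^bsub>V\<^esub> \<in> carrier V" "\<zero>\<^bsub>V\<^esub> \<oplus>\<^bsub>V\<^esub> \<zero>\<^bsub>V\<^esub> = \<zero>\<^bsub>V\<^esub>"
    by simp_all
  show "x \<in> carrier V \<Longrightarrow> y \<in> carrier V \<Longrightarrow> x \<oplus>\<^bsub>V\<^esub> y \<in> carrier V"
    by simp
  show "x \<in> carrier V \<Longrightarrow> a \<odot>\<^bsub>V\<^esub> x \<in> carrier V" "a \<odot>\<^bsub>V\<^esub> \<zero>\<^bsub>V\<^esub> = \<zero>\<^bsub>V\<^esub>"
    using smult_closed[of a x] smult_r_null[of a] by (simp_all add: scalars_def)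
  show "nrm V \<zero>\<^bsub>V\<^esub> = 0"
    using assms by (auto simp: ultrametric_banach_def)
qed

lemma
  assumes "linear_on V W f"
  shows linear_on_add: "x \<in> carrier V \<Longrightarrow> y \<in> carrier V \<Longrightarrow> f (x \<oplus>\<^bsub>V\<^esub> y) = f x \<oplus>\<^bsub>W\<^esub> f y"
    and linear_on_smult: "x \<in> carrier V \<Longrightarrow> f (a \<odot>\<^bsub>V\<^esub> x) = a \<odot>\<^bsub>W\<^esub> f x"
  using assms by (auto simp: linear_on_def)

text \<open>
  The field and the plane have to be moved into the universe by an injection \<open>\<iota>\<close>; the criterion
  reduces the axioms for the copy to those of the original, a vector space filling its type.
\<close>

lemma ultrametric_banachI:
  fixes V :: "('k::field, 'w) nspace" and \<iota> :: "'a::ab_group_add \<Rightarrow> 'w"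
  assumes inj: "inj \<iota>"
    and car: "carrier V = range \<iota>" and zero: "\<zero>\<^bsub>V\<^esub> = \<iota> 0"
    and add: "\<And>x y. \<iota> x \<oplus>\<^bsub>V\<^esub> \<iota> y = \<iota> (x + y)"
    and smult: "\<And>a x. a \<odot>\<^bsub>V\<^esub> \<iota> x = \<iota> (s a x)"
    and nrm: "\<And>x. nrm V (\<iota> x) = N x"
    and vs: "Vector_Spaces.vector_space s"
    and N: "\<And>x. 0 \<le> N x" "\<And>x. N x = 0 \<longleftrightarrow> x = 0" "\<And>a x. N (s a x) = v a * N x"
      "\<And>x y. N (x + y) \<le> max (N x) (N y)" "\<And>x y. N (x - y) = N (y - x)"
    and complete: "\<And>\<sigma> :: nat \<Rightarrow> 'a. \<forall>e>0. \<exists>M. \<forall>m\<ge>M. \<forall>n\<ge>M. N (\<sigma> m - \<sigma> n) < e \<Longrightarrow>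
      \<exists>l. \<forall>e>0. \<exists>M. \<forall>n\<ge>M. N (\<sigma> n - l) < e"
  shows "ultrametric_banach v V"
proof -
  interpret vs: Vector_Spaces.vector_space s
    by (rule vs)
  have group: "abelian_group V"
  proof (rule abelian_groupI)
    fix x
    assume "x \<in> carrier V"
    then obtain x' where "x = \<iota> x'"
      by (auto simp: car)
    thus "\<exists>y\<in>carrier V. y \<oplus>\<^bsub>V\<^esub> x = \<zero>\<^bsub>V\<^esub>"
      by (intro bexI[of _ "\<iota> (- x')"]) (auto simp: car add zero)
  qed (auto simp: car add zero add_ac)
  then interpret V: abelian_group V .
  have module: "Module.module scalars V"
    by (rule Module.moduleI[OF scalars_cring group])
      (auto simp: scalars_def car add smult vs.scale_left_distrib vs.scale_right_distrib)
  have minus: "\<iota> x \<ominus>\<^bsub>V\<^esub> \<iota> y = \<iota> (x - y)" for x y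
  proof -
    have "\<ominus>\<^bsub>V\<^esub> (\<iota> y) = \<iota> (- y)"
      by (rule V.minus_equality) (auto simp: car add zero)
    thus ?thesis
      by (simp add: a_minus_def add)
  qed
  have dist: "norm_dist V (\<iota> x) (\<iota> y) = N (x - y)" for x y
    by (simp add: norm_dist_def car minus nrm)
  interpret M: Metric_space "carrier V" "norm_dist V"
  proof
    show "0 \<le> norm_dist V x y" for x y
    proof (cases "x \<in> carrier V \<and> y \<in> carrier V")
      case True
      then obtain x' y' where "x = \<iota> x'" "y = \<iota> y'"
        unfolding car by blast
      thus ?thesis
        by (simp add: dist N(1))
    qed (auto simp: norm_dist_def)
    show "norm_dist V x y = norm_dist V y x" for x y
    proof (cases "x \<in> carrier V \<and> y \<in> carrier V")
      case True
      then obtain x' y' where "x = \<iota> x'" "y = \<iota> y'"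
        unfolding car by blast
      thus ?thesis
        using N(5)[of x' y'] by (simp only: dist)
    qed (auto simp: norm_dist_def)
    show "norm_dist V x y = 0 \<longleftrightarrow> x = y" if xy: "x \<in> carrier V" "y \<in> carrier V" for x y
    proof -
      obtain x' y' where "x = \<iota> x'" "y = \<iota> y'"
        using xy unfolding car by blast
      thus ?thesis
        by (simp add: dist N(2) inj_eq[OF inj])
    qed
    show "norm_dist V x z \<le> norm_dist V x y + norm_dist V y z"
      if xyz: "x \<in> carrier V" "y \<in> carrier V" "z \<in> carrier V" for x y z
    proof -
      obtain x' y' z' where "x = \<iota> x'" "y = \<iota> y'" "z = \<iota> z'"
        using xyz by (auto simp: car)
      thus ?thesis
        using N(1)[of "x' - y'"] N(1)[of "y' - z'"] N(4)[of "x' - y'" "y' - z'"]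
        by (simp add: dist max_def split: if_splits)
    qed
  qed
  have "M.mcomplete"
    unfolding M.mcomplete_def
  proof (intro allI impI)
    fix \<tau>
    assume \<tau>: "M.MCauchy \<tau>"
    have "\<exists>x. \<tau> n = \<iota> x" for n
      using \<tau> unfolding M.MCauchy_def unfolding car by blast
    then obtain \<sigma> where \<sigma>: "\<tau> = (\<lambda>n. \<iota> (\<sigma> n))"
      by metis
    have "\<forall>e>0. \<exists>M. \<forall>m\<ge>M. \<forall>n\<ge>M. N (\<sigma> m - \<sigma> n) < e"
      using \<tau> by (simp add: M.MCauchy_def \<sigma> dist)
    from complete[OF this] obtain l where "\<forall>e>0. \<exists>M. \<forall>n\<ge>M. N (\<sigma> n - l) < e"
      by blast
    hence "limitin M.mtopology \<tau> (\<iota> l) sequentially"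
      by (simp add: M.limit_metric_sequentially \<sigma> dist) (simp add: car)
    thus "\<exists>x. limitin M.mtopology \<tau> x sequentially"
      by blast
  qed
  thus ?thesis
    using module N(1-4) by (auto simp: ultrametric_banach_def car add smult nrm zero inj_eq[OF inj])
qed

context complete_valued_field
begin

lemma scalar_copy_banach:
  fixes V :: "('k, 'w) nspace"
  assumes "inj \<iota>" "carrier V = range \<iota>" "\<zero>\<^bsub>V\<^esub> = \<iota> 0"
    and "\<And>x y. \<iota> x \<oplus>\<^bsub>V\<^esub> \<iota> y = \<iota> (x + y)"
    and "\<And>a x. a \<odot>\<^bsub>V\<^esub> \<iota> x = \<iota> (a * x)"
    and "\<And>x. nrm V (\<iota> x) = v x"
  shows "ultrametric_banach v V"
proof (rule ultrametric_banachI[OF assms])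
  show "Vector_Spaces.vector_space ((*) :: 'k \<Rightarrow> 'k \<Rightarrow> 'k)"
    by unfold_locales (auto simp: algebra_simps)
  show "\<exists>l. \<forall>e>0. \<exists>M. \<forall>n\<ge>M. v (\<sigma> n - l) < e"
    if "\<forall>e>0. \<exists>M. \<forall>m\<ge>M. \<forall>n\<ge>M. v (\<sigma> m - \<sigma> n) < e" for \<sigma> :: "nat \<Rightarrow> 'k"
    using Cauchy_converges[of \<sigma>] that by metis
qed (auto simp: mult ultrametric minus_commute)

lemma scalar_space_banach: "ultrametric_banach v (scalar_space v)"
  by (rule scalar_copy_banach[of id]) (auto simp: scalar_space_def)

end

section \<open>A plane without orthogonal basis\<close>

text \<open>
  If \<open>\<lambda>\<close> is a pseudo-limit of \<open>lam\<close> in a larger valued field, then the norm of \<open>(x, y)\<close> is the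
  absolute value of \<open>x - y * \<lambda>\<close> up to a constant factor: the plane is a rescaled copy of the
  subspace spanned by \<open>1\<close> and \<open>\<lambda>\<close>.  Writing the norm as a supremum of functionals exhibits the
  plane as a subspace of a bounded power of \<open>k\<close>.
\<close>

definition plane_norm :: "('k::field \<Rightarrow> real) \<Rightarrow> (nat \<Rightarrow> 'k) \<Rightarrow> 'k \<times> 'k \<Rightarrow> real" where
  "plane_norm v lam p = (SUP n. v ((fst p - snd p * lam n) / (lam (Suc n) - lam n)))"

definition plane_smult :: "'k::field \<Rightarrow> 'k \<times> 'k \<Rightarrow> 'k \<times> 'k" where
  "plane_smult a p = (a * fst p, a * snd p)"

definition plane :: "('k::field \<Rightarrow> real) \<Rightarrow> (nat \<Rightarrow> 'k) \<Rightarrow> ('k, 'k \<times> 'k) nspace" where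
  "plane v lam =
     \<lparr>carrier = UNIV, mult = undefined, one = undefined, zero = 0, add = (+),
      smult = plane_smult, nrm = plane_norm v lam\<rparr>"

lemma plane_simps [simp]:
  "carrier (plane v lam) = UNIV" "p \<oplus>\<^bsub>plane v lam\<^esub> q = p + q" "\<zero>\<^bsub>plane v lam\<^esub> = 0"
  "a \<odot>\<^bsub>plane v lam\<^esub> p = plane_smult a p" "nrm (plane v lam) p = plane_norm v lam p"
  by (simp_all add: plane_def)

lemma scalar_space_simps [simp]:
  "carrier (scalar_space v) = UNIV" "x \<oplus>\<^bsub>scalar_space v\<^esub> y = x + y" "\<zero>\<^bsub>scalar_space v\<^esub> = 0"
  "a \<odot>\<^bsub>scalar_space v\<^esub> x = a * x" "nrm (scalar_space v) x = v x"
  by (simp_all add: scalar_space_def)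

context divergent_pseudo_Cauchy
begin

definition coord :: "nat \<Rightarrow> 'k \<times> 'k \<Rightarrow> 'k" where
  "coord n p = (fst p - snd p * lam n) / gap n"

lemma plane_norm_eq: "plane_norm v lam p = (SUP n. v (coord n p))"
  by (simp add: plane_norm_def coord_def)

lemma coord_add: "coord n (p + q) = coord n p + coord n q"
  by (simp add: coord_def algebra_simps flip: add_divide_distrib)

lemma coord_smult: "coord n (plane_smult a p) = a * coord n p"
  by (simp add: coord_def plane_smult_def algebra_simps)

lemma coord_minus: "coord n (- p) = - coord n p"
  by (simp add: coord_def field_simps)

text \<open>
  All coefficients have absolute value at most \<open>1\<close>, so that the relation is one between
  contractions.
\<close>

lemma coord_relation:
  "gap n / gap 0 * coord n p = coord 0 p + (lam 0 - lam n) / gap 0 * snd p"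
  by (simp add: coord_def divide_simps) (simp add: algebra_simps)

lemma coord_bounds:
  obtains C where "\<And>n p. v (coord n p) \<le> C * max (v (fst p)) (v (snd p))"
proof -
  obtain r where r: "0 < r" "\<And>n. r \<le> v (gap n)"
    using gap_bounded_below by blast
  define B where "B = max 1 (max (v (lam 0)) (v (gap 0)))"
  have lam: "v (lam n) \<le> B" for n
    using ultrametric[of "lam n - lam 0" "lam 0"] diff_le_gap[of 0 n] by (auto simp: B_def)
  have "v (coord n p) \<le> B / r * max (v (fst p)) (v (snd p))" for n p
  proof -
    let ?m = "max (v (fst p)) (v (snd p))"
    have "v (fst p - snd p * lam n) \<le> max (v (fst p)) (v (snd p) * v (lam n))"
      using ultrametric_diff[of "fst p" "snd p * lam n"] by (simp add: mult)
    also have "\<dots> \<le> ?m * B"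
    proof (rule max.boundedI)
      have "?m * 1 \<le> ?m * B"
        by (rule mult_left_mono) (auto simp: B_def le_max_iff_disj)
      thus "v (fst p) \<le> ?m * B"
        by simp
      show "v (snd p) * v (lam n) \<le> ?m * B"
        by (rule mult_mono) (auto simp: lam le_max_iff_disj)
    qed
    finally have "v (coord n p) \<le> ?m * B / v (gap n)"
      by (simp add: coord_def divide divide_right_mono)
    also have "\<dots> \<le> ?m * B / r"
      by (rule divide_left_mono) (use r in \<open>auto simp: B_def le_max_iff_disj\<close>)
    finally show ?thesis
      by (simp add: field_simps)
  qed
  thus ?thesis
    by (rule that)
qed

lemma coord_bdd_above: "bdd_above (range (\<lambda>n. v (coord n p)))"
  using coord_bounds by (metis bdd_above.I2)

lemma coord_le_norm: "v (coord n p) \<le> plane_norm v lam p"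
  unfolding plane_norm_eq by (intro cSUP_upper coord_bdd_above) simp

lemma plane_norm_le: "(\<And>n. v (coord n p) \<le> c) \<Longrightarrow> plane_norm v lam p \<le> c"
  unfolding plane_norm_eq by (intro cSUP_least) auto

lemma plane_norm_nonneg: "0 \<le> plane_norm v lam p"
  using coord_le_norm[of 0 p] nonneg[of "coord 0 p"] by linarith

lemma snd_le_norm: "v (snd p) \<le> plane_norm v lam p"
proof -
  have "snd p = coord 0 p - gap 1 / gap 0 * coord 1 p"
    by (simp add: coord_def divide_simps) (simp add: algebra_simps)
  also have "v \<dots> \<le> max (v (coord 0 p)) (v (gap 1) / v (gap 0) * v (coord 1 p))"
    using ultrametric_diff by (metis mult divide)
  also have "\<dots> \<le> max (v (coord 0 p)) (v (coord 1 p))"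
    using gap_strict_antimono[of 0 1]
    by (intro max.mono order_refl mult_left_le_one_le) (auto simp: less_imp_le)
  also have "\<dots> \<le> plane_norm v lam p"
    using coord_le_norm by simp
  finally show ?thesis .
qed

lemma fst_le_norm: "v (fst p) \<le> max (v (gap 0)) (v (lam 0)) * plane_norm v lam p"
proof -
  have "fst p = gap 0 * coord 0 p + lam 0 * snd p"
    by (simp add: coord_def)
  also have "v \<dots> \<le> max (v (gap 0) * v (coord 0 p)) (v (lam 0) * v (snd p))"
    using ultrametric by (metis mult)
  also have "\<dots> \<le> max (v (gap 0)) (v (lam 0)) * plane_norm v lam p"
    by (intro max.boundedI mult_mono coord_le_norm snd_le_norm)
      (auto simp: le_max_iff_disj)
  finally show ?thesis .
qed

text \<open>
  Completeness holds because the norm is equivalent to the maximum norm of \<open>k\<^sup>2\<close>.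
\<close>

lemma plane_copy_banach:
  fixes V :: "('k, 'w) nspace"
  assumes "inj \<iota>" "carrier V = range \<iota>" "\<zero>\<^bsub>V\<^esub> = \<iota> 0"
    and "\<And>p q. \<iota> p \<oplus>\<^bsub>V\<^esub> \<iota> q = \<iota> (p + q)"
    and "\<And>a p. a \<odot>\<^bsub>V\<^esub> \<iota> p = \<iota> (plane_smult a p)"
    and "\<And>p. nrm V (\<iota> p) = plane_norm v lam p"
  shows "ultrametric_banach v V"
proof (rule ultrametric_banachI[OF assms])
  show "Vector_Spaces.vector_space (plane_smult :: 'k \<Rightarrow> _)"
    by unfold_locales (auto simp: plane_smult_def algebra_simps)
  show "0 \<le> plane_norm v lam p" for p
    by (rule plane_norm_nonneg)
  show "plane_norm v lam p = 0 \<longleftrightarrow> p = 0" for p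
  proof
    assume "plane_norm v lam p = 0"
    hence "v (fst p) \<le> 0" "v (snd p) \<le> 0"
      using fst_le_norm[of p] snd_le_norm[of p] by simp_all
    thus "p = 0"
      by (simp add: prod_eq_iff flip: eq_0_iff del: eq_0_iff) (meson nonneg order_antisym)
  qed (simp add: plane_norm_eq coord_def)
  show "plane_norm v lam (plane_smult a p) = v a * plane_norm v lam p" for a p
  proof (cases "a = 0")
    case False
    hence *: "coord n p = inverse a * coord n (plane_smult a p)" for n
      by (simp add: coord_smult)
    have "plane_norm v lam p \<le> v (inverse a) * plane_norm v lam (plane_smult a p)"
      by (rule plane_norm_le, subst *) (simp add: mult mult_left_mono coord_le_norm)
    hence "v a * plane_norm v lam p \<le> plane_norm v lam (plane_smult a p)"
      using False divide[of 1 a] by (simp add: field_simps)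
    moreover have "plane_norm v lam (plane_smult a p) \<le> v a * plane_norm v lam p"
      by (rule plane_norm_le) (simp add: coord_smult mult mult_left_mono coord_le_norm)
    ultimately show ?thesis
      by simp
  qed (simp add: plane_norm_eq coord_def plane_smult_def)
  show "plane_norm v lam (p + q) \<le> max (plane_norm v lam p) (plane_norm v lam q)" for p q
    by (rule plane_norm_le, unfold coord_add, rule order_trans[OF ultrametric max.mono])
      (rule coord_le_norm)+
  show "plane_norm v lam (p - q) = plane_norm v lam (q - p)" for p q
    using coord_minus[of _ "q - p"] by (simp add: plane_norm_eq)
next
  fix \<sigma> :: "nat \<Rightarrow> 'k \<times> 'k"
  assume Cauchy: "\<forall>e>0. \<exists>M. \<forall>m\<ge>M. \<forall>n\<ge>M. plane_norm v lam (\<sigma> m - \<sigma> n) < e"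
  define A where "A = max (v (gap 0)) (v (lam 0))"
  have "0 < A"
    by (simp add: A_def less_max_iff_disj)
  obtain x where x: "\<And>e. e > 0 \<Longrightarrow> \<exists>M. \<forall>n\<ge>M. v (fst (\<sigma> n) - x) < e"
  proof (rule Cauchy_converges[of "\<lambda>n. fst (\<sigma> n)"])
    fix e :: real
    assume "e > 0"
    hence "e / A > 0"
      using \<open>0 < A\<close> by simp
    then obtain M where M: "\<forall>m\<ge>M. \<forall>n\<ge>M. plane_norm v lam (\<sigma> m - \<sigma> n) < e / A"
      using Cauchy by blast
    have "v (fst (\<sigma> m) - fst (\<sigma> n)) < e" if "m \<ge> M" "n \<ge> M" for m n
    proof -
      have "A * plane_norm v lam (\<sigma> m - \<sigma> n) < e"
        using M that \<open>0 < A\<close> by (simp add: field_simps)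
      thus ?thesis
        using fst_le_norm[of "\<sigma> m - \<sigma> n"] by (simp add: A_def)
    qed
    thus "\<exists>M. \<forall>m\<ge>M. \<forall>n\<ge>M. v (fst (\<sigma> m) - fst (\<sigma> n)) < e"
      by blast
  qed blast
  obtain y where y: "\<And>e. e > 0 \<Longrightarrow> \<exists>M. \<forall>n\<ge>M. v (snd (\<sigma> n) - y) < e"
  proof (rule Cauchy_converges[of "\<lambda>n. snd (\<sigma> n)"])
    fix e :: real
    assume "e > 0"
    then obtain M where M: "\<forall>m\<ge>M. \<forall>n\<ge>M. plane_norm v lam (\<sigma> m - \<sigma> n) < e"
      using Cauchy by blast
    have "v (snd (\<sigma> m) - snd (\<sigma> n)) < e" if "m \<ge> M" "n \<ge> M" for m n
      using M that snd_le_norm[of "\<sigma> m - \<sigma> n"] by (metis order_le_less_trans snd_diff)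
    thus "\<exists>M. \<forall>m\<ge>M. \<forall>n\<ge>M. v (snd (\<sigma> m) - snd (\<sigma> n)) < e"
      by blast
  qed blast
  obtain C where C: "\<And>n p. v (coord n p) \<le> C * max (v (fst p)) (v (snd p))"
    using coord_bounds by blast
  define D where "D = max C 1"
  have D: "0 < D" "\<And>p. plane_norm v lam p \<le> D * max (v (fst p)) (v (snd p))"
  proof -
    show "0 < D"
      by (simp add: D_def)
    show "plane_norm v lam p \<le> D * max (v (fst p)) (v (snd p))" for p
      by (rule plane_norm_le, rule order_trans[OF C mult_right_mono])
        (auto simp: D_def le_max_iff_disj)
  qed
  show "\<exists>l. \<forall>e>0. \<exists>M. \<forall>n\<ge>M. plane_norm v lam (\<sigma> n - l) < e"
  proof (intro exI[of _ "(x, y)"] allI impI)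
    fix e :: real
    assume "e > 0"
    hence "e / D > 0"
      using D by simp
    then obtain M1 M2 where M: "\<forall>n\<ge>M1. v (fst (\<sigma> n) - x) < e / D" "\<forall>n\<ge>M2. v (snd (\<sigma> n) - y) < e / D"
      using x y by meson
    have "plane_norm v lam (\<sigma> n - (x, y)) < e" if "n \<ge> max M1 M2" for n
    proof -
      have "max (v (fst (\<sigma> n - (x, y)))) (v (snd (\<sigma> n - (x, y)))) < e / D"
        using M that by simp
      hence "D * max (v (fst (\<sigma> n - (x, y)))) (v (snd (\<sigma> n - (x, y)))) < e"
        using \<open>0 < D\<close> by (simp add: max_def pos_less_divide_eq mult.commute)
      thus ?thesis
        using D(2)[of "\<sigma> n - (x, y)"] by linarith
    qed
    thus "\<exists>M. \<forall>n\<ge>M. plane_norm v lam (\<sigma> n - (x, y)) < e"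
      by blast
  qed
qed

text \<open>
  With \<open>d n = v (gap n)\<close>, the coordinates of \<open>(lam n, 1)\<close> have absolute values \<open>1\<close> below \<open>n\<close>, \<open>0\<close>
  at \<open>n\<close>, and \<open>d n / d m\<close> at \<open>m > n\<close>; the last group, which exceeds \<open>1\<close>, shrinks by the factor
  \<open>d (n + 1) / d n\<close> when \<open>n\<close> moves to \<open>n + 1\<close>.
\<close>

lemma plane_norm_strictly_decreasing:
  "plane_norm v lam (lam (Suc n), 1) < plane_norm v lam (lam n, 1)"
proof -
  let ?N = "plane_norm v lam (lam n, 1)"
  let ?q = "v (gap (Suc n)) / v (gap n)"
  have q: "0 < ?q" "?q < 1"
    using gaps_decrease[of n] by auto
  have coord: "v (coord m (lam i, 1)) = v (gap i) / v (gap m)" if "i < m" for i m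
    using diff_eq_gap[OF that] by (simp add: coord_def divide minus_commute)
  have above: "1 \<le> ?q * ?N"
    using coord_le_norm[of "Suc n" "(lam n, 1)"] coord[of n "Suc n"] q
    by (simp add: field_simps)
  have "v (coord m (lam (Suc n), 1)) \<le> ?q * ?N" for m
  proof (rule linorder_cases[of m "Suc n"])
    assume "m < Suc n"
    hence "v (coord m (lam (Suc n), 1)) = 1"
      using diff_eq_gap[of m "Suc n"] by (simp add: coord_def divide)
    thus ?thesis
      using above by simp
  next
    assume "m = Suc n"
    hence "v (coord m (lam (Suc n), 1)) = 0"
      by (simp add: coord_def)
    thus ?thesis
      using above by linarith
  next
    assume "Suc n < m"
    hence "v (coord m (lam (Suc n), 1)) = ?q * v (coord m (lam n, 1))"
      using coord[of "Suc n" m] coord[of n m] by simp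
    also have "\<dots> \<le> ?q * ?N"
      by (intro mult_left_mono coord_le_norm) (use q in simp)
    finally show ?thesis .
  qed
  hence "plane_norm v lam (lam (Suc n), 1) \<le> ?q * ?N"
    by (rule plane_norm_le)
  also have "0 < ?N"
    using above plane_norm_nonneg[of "(lam n, 1)"] by (cases "?N = 0") auto
  hence "?q * ?N < 1 * ?N"
    using q by (intro mult_strict_right_mono) auto
  finally show ?thesis
    by simp
qed

end

section \<open>Stabilising norms on Reid spaces\<close>

text \<open>
  Quantifying over all surjections from the plane makes the property invariant under isomorphisms
  and lets it pass to the factors of a product.  It holds trivially for spaces of dimension above
  two, among them spaces that contain the plane, such as a bounded power of \<open>k\<close>: surjectivity is
  what tells the plane itself from its superspaces.
\<close>

definition stabilising ::
    "('k::field \<Rightarrow> real) \<Rightarrow> (nat \<Rightarrow> 'k) \<Rightarrow> ('k, 'w) nspace \<Rightarrow> bool" where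
  "stabilising v lam V \<longleftrightarrow>
     (\<forall>T. linear_on (plane v lam) V T \<and> range T = carrier V \<longrightarrow>
          (\<exists>c. \<forall>\<^sub>F n in sequentially. nrm V (T (lam n, 1)) = c))"

lemma (in divergent_pseudo_Cauchy) stabilising_scalar_space:
  "stabilising v lam (scalar_space v)"
  unfolding stabilising_def
proof (intro allI impI, elim conjE)
  fix T
  assume T: "linear_on (plane v lam) (scalar_space v) T"
  have "T (lam n, 1) = T (1, 0) * lam n + T (0, 1)" for n
  proof -
    have "T (plane_smult (lam n) (1, 0) + (0, 1)) = lam n * T (1, 0) + T (0, 1)"
      using linear_on_add[OF T, of "plane_smult (lam n) (1, 0)" "(0, 1)"]
        linear_on_smult[OF T, of "(1, 0)" "lam n"] by (simp del: add_Pair)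
    thus ?thesis
      by (simp add: plane_smult_def mult.commute)
  qed
  thus "\<exists>c. \<forall>\<^sub>F n in sequentially. nrm (scalar_space v) (T (lam n, 1)) = c"
    using eventually_constant[of "T (1, 0)" "T (0, 1)"] by simp
qed

lemma stabilising_isomorphic:
  assumes "V \<cong>\<^sub>B W" "stabilising v lam W"
  shows "stabilising v lam V"
  unfolding stabilising_def
proof (intro allI impI, elim conjE)
  fix T
  assume T: "linear_on (plane v lam) V T" "range T = carrier V"
  obtain f where f: "linear_on V W f" "bij_betw f (carrier V) (carrier W)"
    "\<And>x. x \<in> carrier V \<Longrightarrow> nrm W (f x) = nrm V x"
    using assms(1) by (auto simp: isometrically_isomorphic_def)
  have T_in: "T p \<in> carrier V" for p
    using T(2) by blast
  have "linear_on (plane v lam) W (f \<circ> T)"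
    using T f(1) T_in by (auto simp: linear_on_def Pi_def)
  moreover have "range (f \<circ> T) = carrier W"
    using T(2) f(2) by (metis bij_betw_def image_comp)
  ultimately have "\<exists>c. \<forall>\<^sub>F n in sequentially. nrm W ((f \<circ> T) (lam n, 1)) = c"
    using assms(2) unfolding stabilising_def by blast
  thus "\<exists>c. \<forall>\<^sub>F n in sequentially. nrm V (T (lam n, 1)) = c"
    by (simp add: f(3) T_in)
qed

lemma plane_dependence:
  fixes p q r :: "'k::field \<times> 'k"
  shows "(\<exists>c. p = plane_smult c q) \<or> (\<exists>c. q = plane_smult c p) \<or>
         (\<exists>a b. r = plane_smult a p + plane_smult b q)"
proof -
  obtain p1 p2 q1 q2 r1 r2 where pqr: "p = (p1, p2)" "q = (q1, q2)" "r = (r1, r2)"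
    by (metis surj_pair)
  define d where "d = p1 * q2 - p2 * q1"
  consider "d \<noteq> 0" | "d = 0" "p1 \<noteq> 0" | "d = 0" "p2 \<noteq> 0" | "p1 = 0" "p2 = 0"
    by blast
  thus ?thesis
  proof cases
    case 1
    have "r = plane_smult ((r1 * q2 - r2 * q1) / d) p + plane_smult ((p1 * r2 - p2 * r1) / d) q"
      using 1 by (simp add: pqr plane_smult_def add_divide_distrib[symmetric] eq_divide_eq)
        (simp add: d_def algebra_simps)
    thus ?thesis
      by blast
  next
    case 2
    hence "q = plane_smult (q1 / p1) p"
      by (simp add: pqr plane_smult_def d_def field_simps)
    thus ?thesis
      by blast
  next
    case 3
    hence "q = plane_smult (q2 / p2) p"
      by (simp add: pqr plane_smult_def d_def field_simps)
    thus ?thesis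
      by blast
  next
    case 4
    hence "p = plane_smult 0 q"
      by (simp add: pqr plane_smult_def)
    thus ?thesis
      by blast
  qed
qed

text \<open>
  A linear surjection from the plane onto \<open>X\<close> leaves at most two nonzero factors: vectors supported
  in three different factors would have linearly independent preimages.  Each component is again a
  surjection, so the norm is a supremum of finitely many eventually constant ones.  Only the vectors
  supported in a single factor need to lie in \<open>X\<close>, which covers products and sums at once.
\<close>

lemma stabilising_product:
  fixes W :: "'i \<Rightarrow> ('k::field, 'w) nspace"
  assumes banach: "\<And>i. i \<in> I \<Longrightarrow> ultrametric_banach v (W i)"
    and stab: "\<And>i. i \<in> I \<Longrightarrow> stabilising v lam (W i)"
    and ops: "X = (bounded_product I W)\<lparr>carrier := C\<rparr>"
    and sub: "C \<subseteq> carrier (bounded_product I W)"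
    and single: "\<And>i w. i \<in> I \<Longrightarrow> w \<in> carrier (W i) \<Longrightarrow>
      (\<lambda>j\<in>I. if j = i then w else \<zero>\<^bsub>W j\<^esub>) \<in> C"
  shows "stabilising v lam X"
  unfolding stabilising_def
proof (intro allI impI, elim conjE)
  fix T
  assume T: "linear_on (plane v lam) X T" and surj: "range T = carrier X"
  have range_T: "range T = C"
    using surj by (simp add: ops)
  have T_in: "T p i \<in> carrier (W i)" if "i \<in> I" for p i
    using range_T sub that by (auto simp: bounded_product_def PiE_iff)
  have T_add: "T (p + q) i = T p i \<oplus>\<^bsub>W i\<^esub> T q i" if "i \<in> I" for p q i
    using linear_on_add[OF T, of p q] that by (simp add: ops bounded_product_def)
  have T_smult: "T (plane_smult a p) i = a \<odot>\<^bsub>W i\<^esub> T p i" if "i \<in> I" for a p i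
    using linear_on_smult[OF T, of p a] that by (simp add: ops bounded_product_def)
  have preimage: "\<exists>p. T p i = w \<and> (\<forall>j\<in>I - {i}. T p j = \<zero>\<^bsub>W j\<^esub>)"
    if i: "i \<in> I" and w: "w \<in> carrier (W i)" for i w
  proof -
    obtain p where "T p = (\<lambda>j\<in>I. if j = i then w else \<zero>\<^bsub>W j\<^esub>)"
      using single[OF i w] range_T by (metis rangeE)
    thus ?thesis
      using i by (intro exI[of _ p]) auto
  qed
  define J where "J = {i \<in> I. carrier (W i) \<noteq> {\<zero>\<^bsub>W i\<^esub>}}"
  have nonzero: "\<exists>w\<in>carrier (W i). w \<noteq> \<zero>\<^bsub>W i\<^esub>" if "i \<in> J" for i
    using that zero_closed[OF banach[of i]] by (auto simp: J_def)
  have "finite J"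
  proof (rule ccontr)
    assume inf: "infinite J"
    then obtain i1 where i1: "i1 \<in> J"
      by fastforce
    obtain i2 where i2: "i2 \<in> J" "i2 \<noteq> i1"
      using infinite_imp_nonempty[OF infinite_remove[OF inf, of i1]] by blast
    obtain i3 where i3: "i3 \<in> J" "i3 \<noteq> i1" "i3 \<noteq> i2"
      using infinite_imp_nonempty[OF infinite_remove[OF infinite_remove[OF inf, of i1], of i2]] by blast
    have I: "i1 \<in> I" "i2 \<in> I" "i3 \<in> I"
      using i1 i2 i3 by (auto simp: J_def)
    have "\<exists>p. T p i \<noteq> \<zero>\<^bsub>W i\<^esub> \<and> (\<forall>j\<in>I - {i}. T p j = \<zero>\<^bsub>W j\<^esub>)" if "i \<in> J" for i
      using nonzero[OF that] preimage[of i] that by (auto simp: J_def)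
    then obtain p where p: "\<And>i. i \<in> J \<Longrightarrow> T (p i) i \<noteq> \<zero>\<^bsub>W i\<^esub>"
      "\<And>i j. i \<in> J \<Longrightarrow> j \<in> I \<Longrightarrow> j \<noteq> i \<Longrightarrow> T (p i) j = \<zero>\<^bsub>W j\<^esub>"
      by (metis DiffI singletonD)
    have not_multiple: "p i \<noteq> plane_smult c (p j)" if "i \<in> J" "j \<in> J" "i \<noteq> j" for i j c
    proof
      assume "p i = plane_smult c (p j)"
      hence "T (p i) i = c \<odot>\<^bsub>W i\<^esub> \<zero>\<^bsub>W i\<^esub>"
        using that p(2)[of j i] by (simp add: J_def T_smult)
      thus False
        using p(1)[of i] that smult_zero[OF banach[of i]] by (simp add: J_def)
    qed
    obtain a b where "p i3 = plane_smult a (p i1) + plane_smult b (p i2)"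
      using plane_dependence[of "p i1" "p i2" "p i3"] not_multiple i1 i2 by metis
    hence "T (p i3) i3 = a \<odot>\<^bsub>W i3\<^esub> \<zero>\<^bsub>W i3\<^esub> \<oplus>\<^bsub>W i3\<^esub> b \<odot>\<^bsub>W i3\<^esub> \<zero>\<^bsub>W i3\<^esub>"
      using I i1 i2 i3 p(2)[of i1 i3] p(2)[of i2 i3] by (simp add: T_add T_smult)
    thus False
      using p(1)[OF i3(1)] smult_zero[OF banach[OF I(3)]] add_zero[OF banach[OF I(3)]] by simp
  qed
  have "\<exists>c. \<forall>\<^sub>F n in sequentially. nrm (W i) (T (lam n, 1) i) = c" if "i \<in> I" for i
  proof -
    have "linear_on (plane v lam) (W i) (\<lambda>p. T p i)"
      using that by (simp add: linear_on_def T_in T_add T_smult)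
    moreover have "range (\<lambda>p. T p i) = carrier (W i)"
      using preimage[OF that] T_in[OF that] by (metis image_subsetI rangeI subsetI subset_antisym)
    ultimately show ?thesis
      using stab[OF that] unfolding stabilising_def by blast
  qed
  then obtain c where c: "\<And>i. i \<in> I \<Longrightarrow> \<forall>\<^sub>F n in sequentially. nrm (W i) (T (lam n, 1) i) = c i"
    by metis
  have "\<forall>\<^sub>F n in sequentially. \<forall>i\<in>J. nrm (W i) (T (lam n, 1) i) = c i"
    using \<open>finite J\<close> c by (intro eventually_ball_finite) (auto simp: J_def)
  hence "\<forall>\<^sub>F n in sequentially.
    nrm X (T (lam n, 1)) = Sup (insert 0 ((\<lambda>i. if i \<in> J then c i else 0) ` I))"
  proof eventually_elim
    case (elim n)
    have "nrm (W i) (T (lam n, 1) i) = (if i \<in> J then c i else 0)" if "i \<in> I" for i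
    proof (cases "i \<in> J")
      case False
      hence "T (lam n, 1) i = \<zero>\<^bsub>W i\<^esub>"
        using T_in[OF that] that by (auto simp: J_def)
      thus ?thesis
        using False nrm_zero[OF banach[OF that]] by simp
    qed (use elim in simp)
    thus ?case
      by (simp add: ops bounded_product_def cong: image_cong)
  qed
  thus "\<exists>c. \<forall>\<^sub>F n in sequentially. nrm X (T (lam n, 1)) = c"
    by blast
qed

lemma single_in_bounded_product:
  assumes banach: "\<And>i. i \<in> I \<Longrightarrow> ultrametric_banach v (W i)" and "w \<in> carrier (W i)"
  shows "(\<lambda>j\<in>I. if j = i then w else \<zero>\<^bsub>W j\<^esub>) \<in> carrier (bounded_product I W)"
proof -
  have "bdd_above ((\<lambda>j. nrm (W j) (if j = i then w else \<zero>\<^bsub>W j\<^esub>)) ` I)"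
    by (rule bdd_aboveI[of _ "max 0 (nrm (W i) w)"])
      (auto simp: nrm_zero[OF banach] le_max_iff_disj)
  thus ?thesis
    using assms(2) by (simp add: bounded_product_def PiE_iff zero_closed[OF banach] cong: image_cong)
qed

lemma stabilising_bounded_product:
  assumes "\<And>i. i \<in> I \<Longrightarrow> ultrametric_banach v (W i)" "\<And>i. i \<in> I \<Longrightarrow> stabilising v lam (W i)"
  shows "stabilising v lam (bounded_product I W)"
  by (rule stabilising_product[OF assms, where C = "carrier (bounded_product I W)"])
    (use assms(1) in \<open>auto intro: single_in_bounded_product\<close>)

lemma stabilising_completed_sum:
  assumes "\<And>i. i \<in> I \<Longrightarrow> ultrametric_banach v (W i)" "\<And>i. i \<in> I \<Longrightarrow> stabilising v lam (W i)"
  shows "stabilising v lam (completed_sum I W)"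
proof (rule stabilising_product[OF assms completed_sum_def], goal_cases)
  case (4 i w)
  have "finite {j \<in> I. \<epsilon> \<le> nrm (W j) ((\<lambda>j\<in>I. if j = i then w else \<zero>\<^bsub>W j\<^esub>) j)}" if "\<epsilon> > 0" for \<epsilon> :: real
    by (rule finite_subset[of _ "{i}"])
      (use that in \<open>auto simp: nrm_zero[OF assms(1)] split: if_splits\<close>)
  thus ?case
    using single_in_bounded_product[of I v W, OF assms(1) 4(2)] by blast
qed auto

lemma reid_hierarchy_banach: "reid_hierarchy v \<kappa> \<alpha> \<subseteq> banach_objects v"
  by (subst reid_hierarchy.simps) (auto simp: finite_free_def products_of_def sums_of_def)

lemma (in divergent_pseudo_Cauchy) stabilising_reid_hierarchy:
  "V \<in> reid_hierarchy v \<kappa> \<alpha> \<Longrightarrow> stabilising v lam V"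
proof (induction \<alpha> arbitrary: V rule: wf_induct_rule[OF wf_Ord])
  case (1 \<alpha>)
  define S where "S = (\<Union>\<beta>\<in>underS Ord \<alpha>. reid_hierarchy v \<kappa> \<beta>)"
  have S: "ultrametric_banach v W" "stabilising v lam W" if W: "W \<in> S" for W
  proof -
    obtain \<beta> where \<beta>: "(\<beta>, \<alpha>) \<in> Ord - Id" "W \<in> reid_hierarchy v \<kappa> \<beta>"
      using W unfolding S_def underS_def by blast
    thus "stabilising v lam W"
      by (rule 1(1))
    have "W \<in> banach_objects v"
      using \<beta>(2) reid_hierarchy_banach by blast
    thus "ultrametric_banach v W"
      by (simp add: banach_objects_def)
  qed
  have "V \<in> finite_free v \<union> products_of v \<kappa> S \<union> sums_of v \<kappa> S"
    using 1(2) by (subst (asm) reid_hierarchy.simps) (auto simp: S_def)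
  thus ?case
    using S by (auto simp: finite_free_def products_of_def sums_of_def power_space_def
      intro!: stabilising_bounded_product stabilising_completed_sum
        scalar_space_banach stabilising_scalar_space elim!: stabilising_isomorphic)
qed

section \<open>Reflections\<close>

definition contraction :: "('k, 'a) nspace \<Rightarrow> ('k, 'b) nspace \<Rightarrow> ('a \<Rightarrow> 'b) \<Rightarrow> bool" where
  "contraction V W f \<longleftrightarrow> linear_on V W f \<and> (\<forall>x\<in>carrier V. nrm W (f x) \<le> nrm V x)"

lemma
  assumes "contraction V W f"
  shows contraction_linear: "linear_on V W f"
    and contraction_in: "x \<in> carrier V \<Longrightarrow> f x \<in> carrier W"
    and contraction_le: "x \<in> carrier V \<Longrightarrow> nrm W (f x) \<le> nrm V x"
  using assms by (auto simp: contraction_def linear_on_def)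

lemma contraction_comp:
  assumes "contraction U V f" "contraction V W g"
  shows "contraction U W (\<lambda>x. g (f x))"
proof -
  have "nrm W (g (f x)) \<le> nrm U x" if "x \<in> carrier U" for x
    using contraction_le[OF assms(2) contraction_in[OF assms(1) that]]
      contraction_le[OF assms(1) that] by (rule order_trans)
  thus ?thesis
    using assms by (auto simp: contraction_def linear_on_def Pi_iff)
qed

lemma contraction_ident: "contraction V V (\<lambda>x. x)"
  by (simp add: contraction_def linear_on_def)

lemma Hom_Ban_iff: "f \<in> Hom (Ban v) V W \<longleftrightarrow> f \<in> extensional (carrier V) \<and> contraction V W f"
  by (auto simp: Ban_def contraction_def)

lemma contraction_cong:
  assumes "ultrametric_banach v V" "\<And>x. x \<in> carrier V \<Longrightarrow> f x = g x"
  shows "contraction V W f \<longleftrightarrow> contraction V W g"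
  using assms(2) add_closed[OF assms(1)] smult_closed[OF assms(1)]
  by (auto simp: contraction_def linear_on_def Pi_iff)

lemma restrict_in_Hom:
  assumes "ultrametric_banach v V" "contraction V W f"
  shows "restrict f (carrier V) \<in> Hom (Ban v) V W"
  using contraction_cong[OF assms(1), of "restrict f (carrier V)" f] assms(2)
  by (simp add: Hom_Ban_iff)

text \<open>
  Maps are compared on carriers only, and the carrier of \<open>X\<close> may have any type, so that the plane
  itself rather than its copy in the universe can be reflected.
\<close>

definition is_reflection :: "('k::field \<Rightarrow> real) \<Rightarrow> ('k, 'u::universe) nspace set \<Rightarrow>
    ('k, 'a) nspace \<Rightarrow> ('k, 'u) nspace \<Rightarrow> ('a \<Rightarrow> 'u) \<Rightarrow> bool" where
  "is_reflection v S X R \<eta> \<longleftrightarrow>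
     R \<in> banach_objects v \<inter> S \<and> contraction X R \<eta> \<and>
     (\<forall>Z\<in>banach_objects v \<inter> S.
        (\<forall>f. contraction X Z f \<longrightarrow> (\<exists>g. contraction R Z g \<and> (\<forall>x\<in>carrier X. g (\<eta> x) = f x))) \<and>
        (\<forall>g h. contraction R Z g \<longrightarrow> contraction R Z h \<longrightarrow>
           (\<forall>x\<in>carrier X. g (\<eta> x) = h (\<eta> x)) \<longrightarrow> (\<forall>y\<in>carrier R. g y = h y)))"

lemma
  assumes "is_reflection v S X R \<eta>"
  shows reflection_unit: "contraction X R \<eta>"
    and reflection_in: "R \<in> banach_objects v \<inter> S"
    and reflection_extend: "Z \<in> banach_objects v \<inter> S \<Longrightarrow> contraction X Z f \<Longrightarrow>
      \<exists>g. contraction R Z g \<and> (\<forall>x\<in>carrier X. g (\<eta> x) = f x)"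
    and reflection_unique: "Z \<in> banach_objects v \<inter> S \<Longrightarrow> contraction R Z g \<Longrightarrow> contraction R Z h \<Longrightarrow>
      (\<And>x. x \<in> carrier X \<Longrightarrow> g (\<eta> x) = h (\<eta> x)) \<Longrightarrow> y \<in> carrier R \<Longrightarrow> g y = h y"
  using assms unfolding is_reflection_def by simp_all

text \<open>
  The unit of an adjunction is the image \<open>\<eta>\<close> of the identity; naturality turns the adjunction
  bijection into composition with \<open>\<eta>\<close>.
\<close>

lemma left_adjoint_imp_reflection:
  fixes X :: "('k::field, 'u::universe) nspace"
  assumes "has_left_adjoint (full_subcategory (Ban v) S) (Ban v)
      (inclusion_functor :: (('k, 'u) nspace, 'u \<Rightarrow> 'u, ('k, 'u) nspace, 'u \<Rightarrow> 'u) func)"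
    and X: "X \<in> banach_objects v"
  shows "\<exists>R \<eta>. is_reflection v S X R \<eta>"
proof -
  let ?C = "full_subcategory (Ban v) S"
  let ?Ban = "Ban v :: (('k, 'u) nspace, 'u \<Rightarrow> 'u) cat"
  let ?id = "\<lambda>V :: ('k, 'u) nspace. \<lambda>x\<in>carrier V. x"
  have Obj: "Obj ?C = banach_objects v \<inter> S" "Obj ?Ban = banach_objects v"
    and Hom: "Hom ?C = Hom ?Ban"
    and Ident: "Ident ?C = ?id" "Ident ?Ban = ?id"
    and Comp: "Comp ?C U V W g f = compose (carrier U) g f"
      "Comp ?Ban U V W g f = compose (carrier U) g f" for U V W g f
    by (simp_all add: full_subcategory_def Ban_def)
  obtain L \<phi> where L: "is_functor ?Ban ?C L"
    and bij_all: "\<forall>X\<in>Obj ?Ban. \<forall>Y\<in>Obj ?C. bij_betw (\<phi> X Y) (Hom ?Ban (fobj L X) Y) (Hom ?Ban X Y)"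
    and nat_all: "\<forall>X\<in>Obj ?Ban. \<forall>X'\<in>Obj ?Ban. \<forall>Y\<in>Obj ?C. \<forall>Y'\<in>Obj ?C.
      \<forall>f\<in>Hom ?Ban X' X. \<forall>g\<in>Hom ?Ban Y Y'. \<forall>h\<in>Hom ?Ban (fobj L X) Y.
        \<phi> X' Y' (compose (carrier (fobj L X')) (compose (carrier (fobj L X)) g h) (fmor L X' X f)) =
        compose (carrier X') (compose (carrier X) g (\<phi> X Y h)) f"
    using assms(1) unfolding has_left_adjoint_def is_left_adjoint_def Hom Comp
    by (auto simp: inclusion_functor_def)
  have bij: "bij_betw (\<phi> X Y) (Hom ?Ban (fobj L X) Y) (Hom ?Ban X Y)" if "Y \<in> Obj ?C" for Y
    using bij_all X that by (simp add: Obj)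
  have nat: "\<phi> X Y' (compose (carrier (fobj L X)) (compose (carrier (fobj L X)) g h) (fmor L X X f)) =
      compose (carrier X) (compose (carrier X) g (\<phi> X Y h)) f"
    if "Y \<in> Obj ?C" "Y' \<in> Obj ?C" "f \<in> Hom ?Ban X X" "g \<in> Hom ?Ban Y Y'"
      "h \<in> Hom ?Ban (fobj L X) Y" for Y Y' f g h
    using nat_all X that by (simp add: Obj)
  define R where "R = fobj L X"
  have R: "R \<in> Obj ?C"
    using L X by (simp add: is_functor_def R_def Obj)
  have L_id: "fmor L X X (?id X) = ?id R"
    using L X by (simp add: is_functor_def R_def Obj Ident)
  have banach: "ultrametric_banach v X" "ultrametric_banach v R"
    using X R by (simp_all add: Obj banach_objects_def)
  have ids: "?id X \<in> Hom ?Ban X X" "?id R \<in> Hom ?Ban R R"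
    by (intro restrict_in_Hom banach contraction_ident)+
  define \<eta> where "\<eta> = \<phi> X R (?id R)"
  have \<eta>: "\<eta> \<in> Hom ?Ban X R"
    using bij_betwE[OF bij[OF R]] ids by (simp add: \<eta>_def R_def)
  have unit: "\<phi> X Z g = compose (carrier X) g \<eta>" if "Z \<in> Obj ?C" "g \<in> Hom ?Ban R Z" for Z g
  proof -
    have "\<phi> X Z (compose (carrier R) (compose (carrier R) g (?id R)) (?id R)) =
        compose (carrier X) (compose (carrier X) g \<eta>) (?id X)"
      using nat[folded R_def, OF R that(1) ids(1) that(2) ids(2)] unfolding L_id \<eta>_def .
    moreover have "compose (carrier R) (compose (carrier R) g (?id R)) (?id R) = g"
      using that(2) by (auto simp: compose_def Hom_Ban_iff fun_eq_iff extensional_def)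
    moreover have "compose (carrier X) (compose (carrier X) g \<eta>) (?id X) = compose (carrier X) g \<eta>"
      by (auto simp: compose_def fun_eq_iff)
    ultimately show ?thesis
      by simp
  qed
  have "is_reflection v S X R \<eta>"
    unfolding is_reflection_def
  proof (intro conjI ballI allI impI)
    show "R \<in> banach_objects v \<inter> S" "contraction X R \<eta>"
      using R \<eta> by (simp_all add: Obj Hom_Ban_iff)
  next
    fix Z f
    assume Z: "Z \<in> banach_objects v \<inter> S" and f: "contraction X Z f"
    have "restrict f (carrier X) \<in> \<phi> X Z ` Hom ?Ban R Z"
      using bij_betw_imp_surj_on[OF bij[of Z]] Z restrict_in_Hom[OF banach(1) f]
      by (simp add: Obj R_def)
    then obtain g where g: "g \<in> Hom ?Ban R Z" "restrict f (carrier X) = \<phi> X Z g"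
      by blast
    hence "compose (carrier X) g \<eta> x = restrict f (carrier X) x" for x
      using unit[of Z g] Z by (simp add: Obj)
    hence "g (\<eta> x) = f x" if "x \<in> carrier X" for x
      using that by (metis compose_eq restrict_apply')
    thus "\<exists>g. contraction R Z g \<and> (\<forall>x\<in>carrier X. g (\<eta> x) = f x)"
      using g(1) by (auto simp: Hom_Ban_iff)
  next
    fix Z g h y
    assume Z: "Z \<in> banach_objects v \<inter> S" and gh: "contraction R Z g" "contraction R Z h"
      and eq: "\<forall>x\<in>carrier X. g (\<eta> x) = h (\<eta> x)" and y: "y \<in> carrier R"
    let ?g = "restrict g (carrier R)" and ?h = "restrict h (carrier R)"
    have Hom': "?g \<in> Hom ?Ban R Z" "?h \<in> Hom ?Ban R Z"
      by (intro restrict_in_Hom banach gh)+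
    have "compose (carrier X) ?g \<eta> = compose (carrier X) ?h \<eta>"
      using eq \<eta> by (auto simp: compose_def fun_eq_iff Hom_Ban_iff contraction_in)
    hence "\<phi> X Z ?g = \<phi> X Z ?h"
      using unit[of Z ?g] unit[of Z ?h] Z Hom' by (simp only: Obj)
    hence "?g = ?h"
      using inj_onD[OF bij_betw_imp_inj_on[OF bij[of Z]]] Z Hom' by (simp only: Obj R_def)
    thus "g y = h y"
      using y by (metis restrict_apply')
  qed
  thus ?thesis
    by blast
qed

definition transport :: "('a \<Rightarrow> 'b) \<Rightarrow> ('k, 'a) nspace \<Rightarrow> ('k, 'b) nspace" where
  "transport \<iota> V =
     \<lparr>carrier = \<iota> ` carrier V, mult = undefined, one = undefined, zero = \<iota> \<zero>\<^bsub>V\<^esub>,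
      add = (\<lambda>x y. \<iota> (inv_into UNIV \<iota> x \<oplus>\<^bsub>V\<^esub> inv_into UNIV \<iota> y)),
      smult = (\<lambda>a x. \<iota> (a \<odot>\<^bsub>V\<^esub> inv_into UNIV \<iota> x)),
      nrm = (\<lambda>x. nrm V (inv_into UNIV \<iota> x))\<rparr>"

lemma contraction_transport:
  assumes "inj \<iota>"
  shows "contraction V (transport \<iota> V) \<iota>" "contraction (transport \<iota> V) V (inv_into UNIV \<iota>)"
  using assms by (auto simp: contraction_def linear_on_def transport_def)

lemma reflection_transport_source:
  assumes "inj \<iota>" "is_reflection v S (transport \<iota> X) R \<eta>"
  shows "is_reflection v S X R (\<lambda>x. \<eta> (\<iota> x))"
proof -
  have car: "carrier (transport \<iota> X) = \<iota> ` carrier X"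
    by (simp add: transport_def)
  have "\<exists>g. contraction R Z g \<and> (\<forall>x\<in>carrier X. g (\<eta> (\<iota> x)) = f x)"
    if Z: "Z \<in> banach_objects v \<inter> S" and f: "contraction X Z f" for Z f
  proof -
    have "contraction (transport \<iota> X) Z (\<lambda>x. f (inv_into UNIV \<iota> x))"
      using contraction_comp[OF contraction_transport(2)[OF assms(1)] f] .
    then obtain g where "contraction R Z g" "\<forall>x\<in>\<iota> ` carrier X. g (\<eta> x) = f (inv_into UNIV \<iota> x)"
      using reflection_extend[OF assms(2) Z] unfolding car by blast
    thus ?thesis
      using assms(1) by auto
  qed
  moreover have "contraction X R (\<lambda>x. \<eta> (\<iota> x))"
    using contraction_comp[OF contraction_transport(1)[OF assms(1)] reflection_unit[OF assms(2)]] .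
  moreover have "g y = h y"
    if "Z \<in> banach_objects v \<inter> S" "contraction R Z g" "contraction R Z h"
      "\<forall>x\<in>carrier X. g (\<eta> (\<iota> x)) = h (\<eta> (\<iota> x))" "y \<in> carrier R" for Z g h y
    by (rule reflection_unique[OF assms(2) that(1-3) _ that(5)]) (use that(4) in \<open>auto simp: car\<close>)
  ultimately show ?thesis
    using reflection_in[OF assms(2)] unfolding is_reflection_def by blast
qed

lemma reflection_scalar:
  fixes \<iota> :: "'k::field \<Rightarrow> 'u::universe"
  assumes refl: "is_reflection v S X R \<eta>"
    and \<iota>: "inj \<iota>" "transport \<iota> (scalar_space v) \<in> banach_objects v \<inter> S"
  shows reflection_scalar_extend: "contraction X (scalar_space v) f \<Longrightarrow>
      \<exists>g. contraction R (scalar_space v) g \<and> (\<forall>x\<in>carrier X. g (\<eta> x) = f x)"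
    and reflection_scalar_unique: "contraction R (scalar_space v) g \<Longrightarrow>
      contraction R (scalar_space v) h \<Longrightarrow> (\<And>x. x \<in> carrier X \<Longrightarrow> g (\<eta> x) = h (\<eta> x)) \<Longrightarrow>
      y \<in> carrier R \<Longrightarrow> g y = h y"
proof -
  let ?K = "transport \<iota> (scalar_space v)"
  show "\<exists>g. contraction R (scalar_space v) g \<and> (\<forall>x\<in>carrier X. g (\<eta> x) = f x)"
    if f: "contraction X (scalar_space v) f"
  proof -
    have "contraction X ?K (\<lambda>x. \<iota> (f x))"
      by (rule contraction_comp[OF f contraction_transport(1)[OF \<iota>(1)]])
    then obtain g where g: "contraction R ?K g" "\<forall>x\<in>carrier X. g (\<eta> x) = \<iota> (f x)"
      using reflection_extend[OF refl \<iota>(2)] by blast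
    have "contraction R (scalar_space v) (\<lambda>y. inv_into UNIV \<iota> (g y))"
      by (rule contraction_comp[OF g(1) contraction_transport(2)[OF \<iota>(1)]])
    thus ?thesis
      using g(2) \<iota>(1) by (intro exI[of _ "\<lambda>y. inv_into UNIV \<iota> (g y)"]) simp
  qed
  show "g y = h y"
    if gh: "contraction R (scalar_space v) g" "contraction R (scalar_space v) h"
      and eq: "\<And>x. x \<in> carrier X \<Longrightarrow> g (\<eta> x) = h (\<eta> x)" and y: "y \<in> carrier R"
  proof -
    have "contraction R ?K (\<lambda>y. \<iota> (g y))" "contraction R ?K (\<lambda>y. \<iota> (h y))"
      by (rule contraction_comp[OF _ contraction_transport(1)[OF \<iota>(1)]], fact)+
    hence "\<iota> (g y) = \<iota> (h y)"
      by (rule reflection_unique[OF refl \<iota>(2)]) (simp_all add: eq y)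
    thus ?thesis
      using \<iota>(1) by (simp add: inj_eq)
  qed
qed

lemma reflection_self_unique:
  assumes "is_reflection v S X R \<eta>" "contraction R R g" "\<And>x. x \<in> carrier X \<Longrightarrow> g (\<eta> x) = \<eta> x"
    and "y \<in> carrier R"
  shows "g y = y"
  using reflection_unique[OF assms(1) reflection_in[OF assms(1)] assms(2) contraction_ident] assms(3,4)
  by simp

section \<open>The plane has no reflection\<close>

lemma (in complete_valued_field) contraction_scalar_combination:
  assumes "contraction V (scalar_space v) f" "contraction V (scalar_space v) g"
    and "v a \<le> 1" "v b \<le> 1"
  shows "contraction V (scalar_space v) (\<lambda>x. a * f x + b * g x)"
proof -
  have "v (a * f x + b * g x) \<le> nrm V x" if "x \<in> carrier V" for x
  proof -
    have "v (f x) \<le> nrm V x" "v (g x) \<le> nrm V x"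
      using assms(1,2) that by (auto simp: contraction_def)
    moreover have "v a * v (f x) \<le> v (f x)" "v b * v (g x) \<le> v (g x)"
      using assms(3,4) by (auto intro: mult_left_le_one_le)
    ultimately show ?thesis
      using ultrametric[of "a * f x" "b * g x"] by (simp add: mult)
  qed
  thus ?thesis
    using assms(1,2) by (simp add: contraction_def linear_on_def algebra_simps)
qed

context divergent_pseudo_Cauchy
begin

lemma contraction_coord: "contraction (plane v lam) (scalar_space v) (coord n)"
  by (simp add: contraction_def linear_on_def coord_add coord_smult coord_le_norm del: split_paired_All)

lemma contraction_snd: "contraction (plane v lam) (scalar_space v) snd"
  by (simp add: contraction_def linear_on_def plane_smult_def snd_le_norm del: split_paired_All)

text \<open>
  The extensions \<open>g n\<close> of the coordinates and \<open>y\<close> of the second projection obey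
  \<open>coord_relation\<close>.  Hence \<open>g 0\<close> and \<open>y\<close> determine a point \<open>s z\<close> of the plane whose coordinates
  are all the \<open>g n z\<close>, which bounds its norm, and \<open>s\<close> is inverse to the unit \<open>\<eta>\<close>.
\<close>

lemma no_stabilising_reflection:
  fixes \<iota> :: "'k \<Rightarrow> 'u::universe"
  assumes refl: "is_reflection v S (plane v lam) R \<eta>"
    and \<iota>: "inj \<iota>" "transport \<iota> (scalar_space v) \<in> banach_objects v \<inter> S"
  shows "\<not> stabilising v lam R"
proof
  assume stab: "stabilising v lam R"
  note extend = reflection_scalar_extend[OF refl \<iota>]
    and unique = reflection_scalar_unique[OF refl \<iota>]
  have \<eta>: "contraction (plane v lam) R \<eta>"
    using refl by (simp add: is_reflection_def)
  obtain g where g: "\<And>n. contraction R (scalar_space v) (g n)" "\<And>n p. g n (\<eta> p) = coord n p"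
    using extend[OF contraction_coord] by (simp del: split_paired_All) metis
  obtain y where y: "contraction R (scalar_space v) y" "\<And>p. y (\<eta> p) = snd p"
    using extend[OF contraction_snd] by (auto simp del: split_paired_All)
  \<comment> \<open>solves \<open>coord 0 (s z) = g 0 z\<close> and \<open>snd (s z) = y z\<close>\<close>
  define s where "s z = (gap 0 * g 0 z + lam 0 * y z, y z)" for z
  have coord_s: "coord n (s z) = g n z" if z: "z \<in> carrier R" for n z
  proof -
    have "v (gap n) \<le> v (gap 0)"
      using gap_strict_antimono[of 0 n] by (cases "n = 0") auto
    hence small: "v (gap n / gap 0) \<le> 1" "v ((lam 0 - lam n) / gap 0) \<le> 1"
      using diff_le_gap[of 0 n] by (simp_all add: divide minus_commute[of "lam 0"])
    \<comment> \<open>the relation holds on the range of \<open>\<eta>\<close>; uniqueness applies as both sides are contractions\<close>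
    have "contraction R (scalar_space v) (\<lambda>z. gap n / gap 0 * g n z + 0 * y z)"
      "contraction R (scalar_space v) (\<lambda>z. 1 * g 0 z + (lam 0 - lam n) / gap 0 * y z)"
      by (rule contraction_scalar_combination[OF g(1) y(1)]; use small in simp)+
    hence "gap n / gap 0 * g n z + 0 * y z = 1 * g 0 z + (lam 0 - lam n) / gap 0 * y z"
    proof (rule unique[OF _ _ _ z])
      fix x
      show "gap n / gap 0 * g n (\<eta> x) + 0 * y (\<eta> x) =
          1 * g 0 (\<eta> x) + (lam 0 - lam n) / gap 0 * y (\<eta> x)"
        using coord_relation[of n x] by (simp only: g y mult_1 mult_zero_left add_0_right)
    qed
    moreover have "coord 0 (s z) = g 0 z" "snd (s z) = y z"
      by (simp_all add: s_def coord_def)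
    ultimately have "gap n / gap 0 * coord n (s z) = gap n / gap 0 * g n z"
      using coord_relation[of n "s z"] by simp
    thus ?thesis
      by simp
  qed
  have "contraction R (plane v lam) s"
  proof -
    have "plane_norm v lam (s z) \<le> nrm R z" if "z \<in> carrier R" for z
      by (rule plane_norm_le) (use contraction_le[OF g(1)] that in \<open>simp add: coord_s\<close>)
    moreover have "linear_on R (scalar_space v) (g 0)" "linear_on R (scalar_space v) y"
      using g(1) y(1) by (simp_all add: contraction_def)
    ultimately show ?thesis
      by (simp add: contraction_def linear_on_def s_def plane_smult_def algebra_simps)
  qed
  moreover have s_\<eta>: "s (\<eta> p) = p" for p
    by (simp add: s_def g y) (simp add: coord_def)
  ultimately have \<eta>_s: "\<eta> (s z) = z" if "z \<in> carrier R" for z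
    using reflection_self_unique[OF refl contraction_comp[OF _ \<eta>], of s z] that by simp
  have "range \<eta> = carrier R"
  proof
    show "range \<eta> \<subseteq> carrier R"
      using contraction_in[OF \<eta>] by auto
    show "carrier R \<subseteq> range \<eta>"
      using \<eta>_s by (metis rangeI subsetI)
  qed
  then obtain c where "\<forall>\<^sub>F n in sequentially. nrm R (\<eta> (lam n, 1)) = c"
    using stab contraction_linear[OF \<eta>] unfolding stabilising_def by blast
  moreover have "nrm R (\<eta> p) = plane_norm v lam p" for p
  proof (rule antisym)
    show "nrm R (\<eta> p) \<le> plane_norm v lam p"
      using contraction_le[OF \<eta>, of p] by simp
    show "plane_norm v lam p \<le> nrm R (\<eta> p)"
      by (rule plane_norm_le)
        (use contraction_le[OF g(1), of "\<eta> p"] contraction_in[OF \<eta>, of p] g(2) in simp)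
  qed
  ultimately obtain N where "\<And>n. n \<ge> N \<Longrightarrow> plane_norm v lam (lam n, 1) = c"
    by (auto simp: eventually_sequentially)
  from this[of N] this[of "Suc N"] show False
    using plane_norm_strictly_decreasing[of N] by simp
qed

end

lemma exists_small_injection:
  assumes "|UNIV :: 'a set| <o |UNIV :: 'u::universe set|"
  obtains \<iota> :: "'a \<Rightarrow> 'u::universe" where "inj \<iota>" "small (range \<iota>)"
proof -
  obtain \<iota> :: "'a \<Rightarrow> 'u" where "inj \<iota>"
    using ordLess_imp_ordLeq[OF assms] by (auto simp flip: card_of_ordLeq)
  moreover have "small (range \<iota>)"
    unfolding small_def by (rule ordLeq_ordLess_trans[OF card_of_image assms])
  ultimately show ?thesis
    by (rule that)
qed

lemma square_small:
  assumes "|UNIV :: 'a set| <o |UNIV :: 'u::universe set|"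
  shows "|UNIV :: ('a \<times> 'a) set| <o |UNIV :: 'u::universe set|"
proof (cases "finite (UNIV :: 'a set)")
  case True
  have "infinite (UNIV :: 'u set)"
    using universe_uncountable ordLess_imp_ordLeq infinite_iff_natLeq_ordLeq by blast
  moreover have "finite (UNIV :: ('a \<times> 'a) set)"
    using True by (simp add: finite_prod)
  ultimately show ?thesis
    by (intro finite_ordLess_infinite card_of_Well_order) (auto simp: Field_card_of)
next
  case False
  hence "|(UNIV :: 'a set) \<times> (UNIV :: 'a set)| =o |UNIV :: 'a set|"
    by (rule card_of_Times_same_infinite)
  thus ?thesis
    using assms by (metis UNIV_Times_UNIV ordIso_ordLess_trans)
qed

lemma (in complete_valued_field) scalar_space_in_reid_class:
  fixes \<iota> :: "'k \<Rightarrow> 'u::universe"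
  assumes "inj \<iota>" "small (range \<iota>)"
  shows "transport \<iota> (scalar_space v) \<in> banach_objects v \<inter> reid_class v \<kappa>"
proof -
  let ?K = "transport \<iota> (scalar_space v)"
  have "ultrametric_banach v ?K"
    by (rule scalar_copy_banach[OF assms(1)]) (use assms(1) in \<open>auto simp: transport_def\<close>)
  hence K: "?K \<in> banach_objects v"
    using assms(2) by (simp add: banach_objects_def transport_def)
  have "?K \<cong>\<^sub>B power_space v 1"
    unfolding isometrically_isomorphic_def
  proof (intro exI conjI ballI)
    let ?f = "\<lambda>x. \<lambda>i\<in>{..<1::nat}. inv_into UNIV \<iota> x"
    show "linear_on ?K (power_space v 1) ?f"
      using assms(1) by (auto simp: linear_on_def transport_def power_space_def bounded_product_def)
    show "bij_betw ?f (carrier ?K) (carrier (power_space v 1))"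
      by (rule bij_betw_byWitness[where f' = "\<lambda>w. \<iota> (w 0)"])
        (use assms(1) in \<open>auto simp: transport_def power_space_def bounded_product_def
          PiE_iff extensional_def fun_eq_iff\<close>)
    show "nrm (power_space v 1) (?f x) = nrm ?K x" for x
      by (simp add: transport_def power_space_def bounded_product_def lessThan_Suc cSup_eq_Max)
  qed
  hence "?K \<in> finite_free v"
    using K by (auto simp: finite_free_def)
  (* every level contains the finite free spaces *)
  hence "?K \<in> reid_hierarchy v \<kappa> undefined"
    by (subst reid_hierarchy.simps) simp
  thus ?thesis
    using K by (auto simp: reid_class_def)
qed

theorem theorem6p8:
  fixes v :: "'k::field \<Rightarrow> real"
    and \<kappa> :: "'u::universe rel"
  assumes field_is_a_set: "|UNIV :: 'k set| <o |UNIV :: 'u set|"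
    and complete_field: "complete_valuation v"
    and dense: "{0..} \<subseteq> closure (range v)"
    and not_spherical: "\<not> spherically_complete v"
    and kappa: "infinite_cardinal_or_Ord \<kappa>"
    and non_measurable: "non_measurability_condition \<kappa>"
  shows "\<not> has_left_adjoint (reid_category v \<kappa>) (Ban v)
           (inclusion_functor ::
              (('k, 'u) nspace, 'u \<Rightarrow> 'u, ('k, 'u) nspace, 'u \<Rightarrow> 'u) func)"
proof
  assume adjoint: "has_left_adjoint (reid_category v \<kappa>) (Ban v)
           (inclusion_functor ::
              (('k, 'u) nspace, 'u \<Rightarrow> 'u, ('k, 'u) nspace, 'u \<Rightarrow> 'u) func)"
  interpret complete_valued_field v
    by unfold_locales (rule complete_field)
  obtain lam where "divergent_pseudo_Cauchy v lam"
    using not_spherically_complete_imp_divergent[OF not_spherical] by blast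
  then interpret divergent_pseudo_Cauchy v lam .
  obtain \<iota> :: "'k \<Rightarrow> 'u" where \<iota>: "inj \<iota>" "small (range \<iota>)"
    using exists_small_injection[OF field_is_a_set] by blast
  obtain \<tau> :: "'k \<times> 'k \<Rightarrow> 'u" where \<tau>: "inj \<tau>" "small (range \<tau>)"
    using exists_small_injection[OF square_small[OF field_is_a_set]] by blast
  have "ultrametric_banach v (transport \<tau> (plane v lam))"
    by (rule plane_copy_banach[OF \<tau>(1)]) (use \<tau>(1) in \<open>simp_all add: transport_def\<close>)
  hence "transport \<tau> (plane v lam) \<in> banach_objects v"
    using \<tau>(2) by (simp add: banach_objects_def transport_def)
  then obtain R \<eta> where "is_reflection v (reid_class v \<kappa>) (transport \<tau> (plane v lam)) R \<eta>"
    using left_adjoint_imp_reflection adjoint unfolding reid_category_def by blast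
  hence refl: "is_reflection v (reid_class v \<kappa>) (plane v lam) R (\<lambda>p. \<eta> (\<tau> p))"
    by (rule reflection_transport_source[OF \<tau>(1)])
  hence "R \<in> reid_class v \<kappa>"
    by (simp add: is_reflection_def)
  hence "stabilising v lam R"
    using stabilising_reid_hierarchy by (auto simp: reid_class_def)
  thus False
    using no_stabilising_reflection[OF refl \<iota>(1) scalar_space_in_reid_class[OF \<iota>]] by blast
qed

end
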